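(* Let $A\in\mathbb{R}^{m\times n}$, let $\bar\lambda\ge\lambda>0$, and let $\mathcal{D}$ be a probability distribution over subsets of $[m]$ such that the regularized projection matrix $P_{\lambda,S}:=A_S^\top(A_SA_S^\top+\lambda I)^{-1}A_S$ satisfies $$\bar P_\lambda:=\mathbb{E}_{S\sim\mathcal{D}}[P_{\lambda,S}]\succeq c\,A^\top A(A^\top A+\bar\lambda I)^{-1}$$ for some $c\in(0,1]$. Assume that $A_S^\top A_S\preceq\alpha A^\top A$ holds with probability $1-\delta'$ for some $\alpha\in[0,1]$ and $\delta'\in[0,\alpha/\|\bar P_\lambda^\dagger\|]$. Let $\mathcal{B}=\{S_i\}_{i=1}^B$ be a collection of $B$ independent samples from $\mathcal{D}$. If $B\ge\frac{40}{c}\big(1+\alpha\frac{\bar\lambda}{\lambda}\big)\log(2n/\delta)$ for some $\delta\in(0,1)$, then with probability $1-B\delta'-\delta$ the collection $\mathcal{B}$ satisfies $$\frac1B\sum_{j=1}^BP_{\lambda,S_j}\succeq\frac12\bar P_\lambda.$$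
   Context: $A_S$ is the submatrix of rows of $A$ indexed by $S$; $M^\dagger$ is the Moore-Penrose pseudoinverse; $\|\cdot\|$ is the spectral norm; $\succeq,\preceq$ denote the positive semidefinite (Loewner) order. *)

theory Defs
  imports "HOL-Analysis.Analysis" "HOL-Probability.Probability"
begin

text \<open>
  The submatrix \<open>A\<^sub>S\<close> is a matrix whose rows are indexed by the set \<open>S\<close>, and its Gram matrix
  \<open>A\<^sub>S A\<^sub>S\<^sup>T\<close> is an \<open>S \<times> S\<close> matrix. As \<open>S\<close> is not a type, matrices over such index sets are
  functions of two indices, of which only the entries with indices in the relevant sets
  have a meaning.
\<close>

definition row_submatrix :: "real^'n^'m \<Rightarrow> 'm set \<Rightarrow> 'm \<Rightarrow> 'n \<Rightarrow> real" where
  "row_submatrix A S = (\<lambda>i\<in>S. \<lambda>a. A $ i $ a)"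

text \<open>The set argument is the index set that is summed over.\<close>

definition idx_mult :: "'k set \<Rightarrow> ('i \<Rightarrow> 'k \<Rightarrow> real) \<Rightarrow> ('k \<Rightarrow> 'j \<Rightarrow> real) \<Rightarrow> 'i \<Rightarrow> 'j \<Rightarrow> real" where
  "idx_mult K X Y = (\<lambda>i j. \<Sum>k\<in>K. X i k * Y k j)"

definition idx_transpose :: "('i \<Rightarrow> 'j \<Rightarrow> real) \<Rightarrow> 'j \<Rightarrow> 'i \<Rightarrow> real" where
  "idx_transpose X = (\<lambda>j i. X i j)"

text \<open>The scalar matrix \<open>k I\<close>.\<close>

definition idx_mat :: "real \<Rightarrow> 'i \<Rightarrow> 'i \<Rightarrow> real" where
  "idx_mat k = (\<lambda>i j. if i = j then k else 0)"

text \<open>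
  The analogue of \<^const>\<open>matrix_inv\<close> for \<open>S \<times> S\<close> matrices. On \<open>S \<times> S\<close> the result is unique if
  it exists; the entries elsewhere are unspecified and must not be used.
\<close>

definition idx_inv :: "'i set \<Rightarrow> ('i \<Rightarrow> 'i \<Rightarrow> real) \<Rightarrow> 'i \<Rightarrow> 'i \<Rightarrow> real" where
  "idx_inv S X = (SOME Y. \<forall>i\<in>S. \<forall>j\<in>S.
     idx_mult S X Y i j = idx_mat 1 i j \<and> idx_mult S Y X i j = idx_mat 1 i j)"

text \<open>\<open>A\<^sub>S\<^sup>T A\<^sub>S\<close>\<close>

definition sub_gram :: "real^'n^'m \<Rightarrow> 'm set \<Rightarrow> real^'n^'n" where
  "sub_gram A S = (\<chi> a b.
     idx_mult S (idx_transpose (row_submatrix A S)) (row_submatrix A S) a b)"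

text \<open>\<open>P\<^bsub>l,S\<^esub> = A\<^sub>S\<^sup>T (A\<^sub>S A\<^sub>S\<^sup>T + l I)\<^sup>-\<^sup>1 A\<^sub>S\<close>\<close>

definition reg_proj :: "real^'n^'m \<Rightarrow> real \<Rightarrow> 'm set \<Rightarrow> real^'n^'n" where
  "reg_proj A l S =
    (let M = row_submatrix A S;
         G = (\<lambda>i j. idx_mult UNIV M (idx_transpose M) i j + idx_mat l i j)
     in \<chi> a b. idx_mult S (idx_mult S (idx_transpose M) (idx_inv S G)) M a b)"

text \<open>Symmetry is part of the definition: it does not follow from the quadratic form over the reals.\<close>

definition psd :: "real^'n^'n \<Rightarrow> bool" where
  "psd M \<longleftrightarrow> transpose M = M \<and> (\<forall>x. 0 \<le> x \<bullet> (M *v x))"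

definition loewner_le :: "real^'n^'n \<Rightarrow> real^'n^'n \<Rightarrow> bool"  (infix \<open>\<preceq>\<^sub>L\<close> 50) where
  "X \<preceq>\<^sub>L Y \<longleftrightarrow> psd (Y - X)"

definition is_pinv :: "real^'n^'m \<Rightarrow> real^'m^'n \<Rightarrow> bool" where
  "is_pinv M X \<longleftrightarrow> M ** X ** M = M \<and> X ** M ** X = X \<and>
     transpose (M ** X) = M ** X \<and> transpose (X ** M) = X ** M"

text \<open>The Moore-Penrose pseudoinverse: the unique solution of the four Penrose equations.\<close>

definition pinv :: "real^'n^'m \<Rightarrow> real^'m^'n" where
  "pinv M = (THE X. is_pinv M X)"

text \<open>\<^const>\<open>norm\<close> on matrices is the Frobenius norm, hence the operator norm here.\<close>

definition spectral_norm :: "real^'n^'m \<Rightarrow> real" where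
  "spectral_norm M = onorm (\<lambda>x. M *v x)"

text \<open>
  The inverse used in \<^const>\<open>reg_proj\<close> exists for every \<open>l > 0\<close>.
\<close>

lemma ex_idx_inv:
  fixes A :: "real^'n^'m"
  defines "G \<equiv> \<lambda>S l i j. idx_mult UNIV (row_submatrix A S) (idx_transpose (row_submatrix A S)) i j
                 + idx_mat l i j"
  assumes "l > 0" "i \<in> S" "j \<in> S"
  shows "idx_mult S (G S l) (idx_inv S (G S l)) i j = idx_mat 1 i j"
    and "idx_mult S (idx_inv S (G S l)) (G S l) i j = idx_mat 1 i j"
proof -
  define N :: "real^'n^'m" where "N = (\<chi> i a. if i \<in> S then A $ i $ a else 0)"
  define K :: "real^'m^'m" where "K = N ** transpose N + mat l"
  have Kx: "K *v x = N *v (transpose N *v x) + l *\<^sub>R x" for x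
  proof -
    have "mat l *v x = l *\<^sub>R x"
      by (simp add: vec_eq_iff mat_def matrix_vector_mult_def if_distrib if_distribR sum.delta cong: if_cong)
    then show ?thesis
      by (simp add: K_def matrix_vector_mult_add_rdistrib matrix_vector_mul_assoc
          del: transpose_matrix_vector)
  qed
  have "x = 0" if "K *v x = 0" for x
  proof -
    have "0 = x \<bullet> (K *v x)" using that by simp
    also have "\<dots> = (transpose N *v x) \<bullet> (transpose N *v x) + l * (x \<bullet> x)"
      by (simp add: Kx inner_add_right dot_lmul_matrix[symmetric])
    finally have "l * (x \<bullet> x) \<le> 0"
      using inner_ge_zero[of "transpose N *v x"] by linarith
    with \<open>l > 0\<close> show "x = 0"
      by (metis inner_gt_zero_iff mult_pos_pos not_less)
  qed
  then obtain L where L: "L ** K = mat 1"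
    using matrix_left_invertible_ker[of K] by blast
  then have R: "K ** L = mat 1"
    using matrix_left_right_inverse by blast
  have KG: "K $ p $ q = G S l p q" if "p \<in> S" "q \<in> S" for p q
    using that by (simp add: K_def G_def N_def matrix_matrix_mult_def transpose_def mat_def
        idx_mult_def idx_transpose_def idx_mat_def row_submatrix_def)
  have K0: "K $ p $ q = 0" if "p \<in> S \<longleftrightarrow> q \<notin> S" for p q
    using that by (auto simp: K_def N_def matrix_matrix_mult_def transpose_def mat_def)
  have 1: "idx_mult S (G S l) (\<lambda>p q. L $ p $ q) p q = idx_mat 1 p q" if "p \<in> S" "q \<in> S" for p q
  proof -
    have "(\<Sum>k\<in>S. G S l p k * L $ k $ q) = (\<Sum>k\<in>UNIV. K $ p $ k * L $ k $ q)"
      by (rule sum.mono_neutral_cong_left) (use that in \<open>auto simp: KG K0\<close>)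
    also have "\<dots> = (K ** L) $ p $ q" by (simp add: matrix_matrix_mult_def)
    finally show ?thesis by (simp add: R idx_mult_def idx_mat_def mat_def)
  qed
  have 2: "idx_mult S (\<lambda>p q. L $ p $ q) (G S l) p q = idx_mat 1 p q" if "p \<in> S" "q \<in> S" for p q
  proof -
    have "(\<Sum>k\<in>S. L $ p $ k * G S l k q) = (\<Sum>k\<in>UNIV. L $ p $ k * K $ k $ q)"
      by (rule sum.mono_neutral_cong_left) (use that in \<open>auto simp: KG K0\<close>)
    also have "\<dots> = (L ** K) $ p $ q" by (simp add: matrix_matrix_mult_def)
    finally show ?thesis by (simp add: L idx_mult_def idx_mat_def mat_def)
  qed
  have "\<forall>i\<in>S. \<forall>j\<in>S. idx_mult S (G S l) (idx_inv S (G S l)) i j = idx_mat 1 i j \<and>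
      idx_mult S (idx_inv S (G S l)) (G S l) i j = idx_mat 1 i j"
    unfolding idx_inv_def by (rule someI[of _ "\<lambda>p q. L $ p $ q"]) (use 1 2 in blast)
  with assms show "idx_mult S (G S l) (idx_inv S (G S l)) i j = idx_mat 1 i j"
    and "idx_mult S (idx_inv S (G S l)) (G S l) i j = idx_mat 1 i j" by blast+
qed

end

theory Submission
  imports Defs
begin

text \<open>
  The conclusion is a lower matrix Chernoff bound for the random matrices \<open>P\<^bsub>lam,S\<^esub>\<close>, measured
  relative to their expectation \<open>P_bar\<close>. Such a bound needs two facts about the summands: an
  upper bound \<open>R P_bar\<close> that holds for every outcome, and a lower bound on their expectation.

  The upper bound comes from Tikhonov regularization. The quadratic form of \<open>G (G + l I)\<^sup>-\<^sup>1\<close> at \<open>x\<close>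
  is the minimum over \<open>y\<close> of \<open>\<bar>x - y\<bar>\<^sup>2 + (y \<bullet> G y) / l\<close>. If \<open>A\<^sub>S\<^sup>T A\<^sub>S\<close> is at most
  \<open>\<alpha> A\<^sup>T A\<close>, inserting the minimiser for \<open>A\<^sup>T A\<close> and \<open>lam_bar\<close> into the functional for
  \<open>A\<^sub>S\<^sup>T A\<^sub>S\<close> and \<open>lam\<close> costs at most a factor \<open>max 1 (\<alpha> lam_bar / lam)\<close>
  (lemma \<open>regularized_mono\<close>). Together with the assumed lower bound on \<open>P_bar\<close> this allows
  \<open>R = max 1 (\<alpha> lam_bar / lam) / c\<close>.

  If \<open>\<alpha> \<ge> 1/4\<close>, the bound with \<open>\<alpha> = 1\<close>, which holds for every \<open>S\<close>, loses only a factor 4,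
  and nothing needs to be dropped. If \<open>\<alpha> < 1/4\<close>, the
  matrices of the exceptional sets are replaced by 0. This decreases the sum, and the
  hypothesis on \<open>\<delta>'\<close> guarantees that the expectation keeps the fraction \<open>1 - \<alpha> > 3/4\<close>
  (lemma \<open>truncated_expectation_lower_bound\<close>). The full sum dominates the truncated one in
  every outcome and so inherits its lower bound.

  The Chernoff bound rests on the potential \<open>trace (exp (- K))\<close>, where \<open>K\<close> is the partial sum.
  Adding an independent summand \<open>W\<close> with \<open>0 \<le> W \<le> I/2\<close> decreases it by at least
  3/4 of \<open>trace (W exp (- K))\<close> (lemma \<open>exp_trace_step\<close>). This estimate is linear in \<open>W\<close>, so
  that one can take expectations. It replaces the Golden-Thompson inequality and is more
  elementary: in the eigenbases of \<open>K\<close> and \<open>K + W\<close> it is a weighted sum of instances of an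
  inequality between real numbers.
\<close>

section \<open>Quadratic forms\<close>

lemma psd_symmetric: "psd M \<Longrightarrow> transpose M = M"
  by (simp add: psd_def)

lemma psd_nonneg: "psd M \<Longrightarrow> 0 \<le> x \<bullet> (M *v x)"
  by (simp add: psd_def)

lemma inner_symmetric_matrix:
  fixes M :: "real^'n^'n"
  assumes "transpose M = M"
  shows "x \<bullet> (M *v y) = (M *v x) \<bullet> y"
  by (metis assms dot_lmul_matrix transpose_matrix_vector)

lemma transpose_diff: "transpose (X - Y) = transpose X - transpose (Y :: real^'n^'m)"
  by (simp add: transpose_def vec_eq_iff)

lemma transpose_add: "transpose (X + Y) = transpose X + transpose (Y :: real^'n^'m)"
  by (simp add: transpose_def vec_eq_iff)

lemma transpose_scaleR: "transpose (k *\<^sub>R X) = k *\<^sub>R transpose (X :: real^'n^'m)"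
  by (simp add: transpose_def vec_eq_iff)

lemma transpose_sum: "transpose (\<Sum>i\<in>I. f i) = (\<Sum>i\<in>I. transpose (f i :: real^'n^'m))"
  by (induction I rule: infinite_finite_induct)
     (simp_all add: transpose_add, simp_all add: transpose_def vec_eq_iff)

lemma matrix_vector_mult_sum: "(\<Sum>i\<in>I. f i) *v x = (\<Sum>i\<in>I. (f i :: real^'n^'m) *v x)"
  by (induction I rule: infinite_finite_induct) (simp_all add: matrix_vector_mult_add_rdistrib)

lemma matrix_scaleR_mult_vector: "(k *\<^sub>R M) *v x = k *\<^sub>R ((M :: real^'n^'m) *v x)"
  by (simp add: scaleR_matrix_vector_assoc)

lemma loewner_leI:
  assumes "transpose X = X" "transpose Y = Y" "\<And>x. x \<bullet> (X *v x) \<le> x \<bullet> (Y *v x)"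
  shows "X \<preceq>\<^sub>L Y"
  using assms
  by (simp add: loewner_le_def psd_def transpose_diff matrix_vector_mult_diff_rdistrib inner_diff_right)

lemma loewner_leD: "X \<preceq>\<^sub>L Y \<Longrightarrow> x \<bullet> (X *v x) \<le> x \<bullet> (Y *v x)"
  by (simp add: loewner_le_def psd_def matrix_vector_mult_diff_rdistrib inner_diff_right)

text \<open>
  A quadratic polynomial without constant term can only be nonnegative everywhere if its
  linear term vanishes; this is the first-order condition at a minimum.
\<close>

lemma linear_term_eq_0:
  fixes b c :: real
  assumes "\<And>t. 0 \<le> t * b + t\<^sup>2 * c"
  shows "b = 0"
proof (rule ccontr)
  assume "b \<noteq> 0"
  define t where "t = - b / (\<bar>c\<bar> + 1)"
  have "t * b + t\<^sup>2 * c \<le> t * b + t\<^sup>2 * \<bar>c\<bar>"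
    by (simp add: mult_left_mono)
  also have "\<dots> < t * b + t\<^sup>2 * (\<bar>c\<bar> + 1)"
    using \<open>b \<noteq> 0\<close> by (simp add: t_def add_nonneg_eq_0_iff)
  also have "t\<^sup>2 * (\<bar>c\<bar> + 1) = - (t * b)"
    by (simp add: t_def power2_eq_square divide_simps)
  finally show False using assms[of t] by simp
qed

text \<open>The Cauchy-Schwarz inequality for the semi-inner product of a positive semidefinite matrix.\<close>

lemma psd_Cauchy_Schwarz:
  assumes "psd W"
  shows "(x \<bullet> (W *v y))\<^sup>2 \<le> (x \<bullet> (W *v x)) * (y \<bullet> (W *v y))"
proof -
  let ?a = "x \<bullet> (W *v x)" and ?b = "x \<bullet> (W *v y)" and ?d = "y \<bullet> (W *v y)"
  have sym: "y \<bullet> (W *v x) = ?b"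
    using inner_symmetric_matrix[OF psd_symmetric[OF assms]] by (metis inner_commute)
  have q: "0 \<le> s * s * ?a + 2 * s * t * ?b + t * t * ?d" for s t
    using psd_nonneg[OF assms, of "s *\<^sub>R x + t *\<^sub>R y"] sym
    by (simp add: matrix_vector_right_distrib matrix_vector_mult_scaleR inner_add_left inner_add_right
        algebra_simps)
  show ?thesis
  proof (cases "?d = 0")
    case True
    have "2 * ?b = 0"
      by (rule linear_term_eq_0[of _ ?a]) (use q[of _ 1] True in \<open>simp add: algebra_simps power2_eq_square\<close>)
    then show ?thesis using True by simp
  next
    case False
    then have "?d > 0" using psd_nonneg[OF assms, of y] by linarith
    have "0 \<le> ?d * (?d * ?a - ?b * ?b)"
      using q[of ?d "- ?b"] by (simp add: algebra_simps)
    then have "0 \<le> ?d * ?a - ?b * ?b"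
      using \<open>?d > 0\<close> by (simp add: zero_le_mult_iff)
    then show ?thesis by (simp add: power2_eq_square algebra_simps)
  qed
qed

section \<open>Spectral decomposition\<close>

text \<open>
  Indexing the basis by the type of the coordinates encodes that it has as many elements as the
  space has dimensions, so that orthonormality already implies completeness.
\<close>

definition eigensystem :: "real^'n^'n \<Rightarrow> ('n \<Rightarrow> real^'n) \<Rightarrow> ('n \<Rightarrow> real) \<Rightarrow> bool" where
  "eigensystem K v k \<longleftrightarrow> (\<forall>i j. v i \<bullet> v j = (if i = j then 1 else 0)) \<and> (\<forall>i. K *v v i = k i *\<^sub>R v i)"

lemma eigensystem_norm: "eigensystem K v k \<Longrightarrow> v i \<bullet> v i = 1"
  by (simp add: eigensystem_def)

lemma eigensystem_vector: "eigensystem K v k \<Longrightarrow> K *v v i = k i *\<^sub>R v i"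
  by (simp add: eigensystem_def)

lemma eigensystem_inner:
  fixes K :: "real^'n^'n"
  assumes "eigensystem K v k"
  shows "x \<bullet> y = (\<Sum>i\<in>UNIV. (x \<bullet> v i) * (y \<bullet> v i))"
proof -
  define Q :: "real^'n^'n" where "Q = (\<chi> i. v i)"
  have "Q ** transpose Q = mat 1"
    using assms
    by (simp add: Q_def vec_eq_iff matrix_matrix_mult_def transpose_def mat_def eigensystem_def
        inner_vec_def)
  then have "transpose Q ** Q = mat 1"
    using matrix_left_right_inverse by blast
  then have "x \<bullet> y = x \<bullet> (transpose Q *v (Q *v y))"
    by (simp add: matrix_vector_mul_assoc del: transpose_matrix_vector)
  also have "\<dots> = (Q *v x) \<bullet> (Q *v y)"
    using dot_lmul_matrix[of "Q *v y" Q x] by (simp add: inner_commute)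
  also have "\<dots> = (\<Sum>i\<in>UNIV. (x \<bullet> v i) * (y \<bullet> v i))"
    by (simp add: inner_vec_def[of "Q *v x"] Q_def matrix_vector_mult_def inner_vec_def mult.commute)
  finally show ?thesis .
qed

lemma eigensystem_expand:
  assumes "eigensystem K v k"
  shows "x = (\<Sum>i\<in>UNIV. (x \<bullet> v i) *\<^sub>R v i)"
proof (rule vector_eq_ldot[THEN iffD1], rule allI)
  fix z
  show "z \<bullet> x = z \<bullet> (\<Sum>i\<in>UNIV. (x \<bullet> v i) *\<^sub>R v i)"
    using eigensystem_inner[OF assms, of z x] by (simp add: inner_sum_right mult.commute)
qed

text \<open>
  A symmetric matrix maps the orthogonal complement of a set of eigenvectors to itself, and
  on such a complement the maximiser of the Rayleigh quotient is a further eigenvector. A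
  maximal orthonormal set of eigenvectors therefore spans the space.
\<close>

lemma exists_orthogonal_eigenvector:
  fixes K :: "real^'n^'n"
  assumes sym: "transpose K = K"
    and eig: "\<And>x. x \<in> S \<Longrightarrow> \<exists>l. K *v x = l *\<^sub>R x"
    and z: "z \<noteq> 0" "\<And>x. x \<in> S \<Longrightarrow> orthogonal x z"
  shows "\<exists>y l. norm y = 1 \<and> (\<forall>x\<in>S. orthogonal x y) \<and> K *v y = l *\<^sub>R y"
proof -
  define V where "V = {y. \<forall>x\<in>S. orthogonal x y}"
  have V: "subspace V"
    unfolding V_def by (rule subspace_orthogonal_to_vectors)
  have KV: "K *v y \<in> V" if "y \<in> V" for y
  proof -
    have "x \<bullet> (K *v y) = 0" if "x \<in> S" for x
    proof -
      obtain l where "K *v x = l *\<^sub>R x" using eig \<open>x \<in> S\<close> by blast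
      then show ?thesis
        using \<open>y \<in> V\<close> \<open>x \<in> S\<close> inner_symmetric_matrix[OF sym, of x y]
        by (simp add: V_def orthogonal_def)
    qed
    then show ?thesis by (simp add: V_def orthogonal_def)
  qed
  have "compact (V \<inter> sphere 0 1)"
    by (intro closed_Int_compact closed_subspace V compact_sphere)
  moreover have "(1 / norm z) *\<^sub>R z \<in> V \<inter> sphere 0 1"
    using z by (simp add: V_def orthogonal_def)
  moreover have "continuous_on (V \<inter> sphere 0 1) (\<lambda>y. y \<bullet> (K *v y))"
    by (intro continuous_intros linear_continuous_on linear_linear[THEN iffD2] matrix_vector_mul_linear)
  ultimately obtain y where y: "y \<in> V" "norm y = 1"
    and max: "\<And>u. u \<in> V \<Longrightarrow> norm u = 1 \<Longrightarrow> u \<bullet> (K *v u) \<le> y \<bullet> (K *v y)"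
    using continuous_attains_sup[of "V \<inter> sphere 0 1" "\<lambda>y. y \<bullet> (K *v y)"]
    by (metis IntE IntI emptyE mem_sphere_0)
  define l where "l = y \<bullet> (K *v y)"
  have max': "u \<bullet> (K *v u) \<le> l * (u \<bullet> u)" if "u \<in> V" for u
  proof (cases "u = 0")
    case False
    have "((1 / norm u) *\<^sub>R u) \<bullet> (K *v ((1 / norm u) *\<^sub>R u)) \<le> l"
      unfolding l_def using max[of "(1 / norm u) *\<^sub>R u"] V that False by (simp add: subspace_scale)
    then have "(u \<bullet> (K *v u)) / (u \<bullet> u) \<le> l"
      by (simp add: matrix_vector_mult_scaleR dot_square_norm power2_eq_square)
    then show ?thesis using False by (simp add: pos_divide_le_eq)
  qed simp
  define d where "d = K *v y - l *\<^sub>R y"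
  have "d \<in> V" unfolding d_def using y KV V by (simp add: subspace_diff subspace_scale)
  have yy: "y \<bullet> y = 1" using y by (simp add: dot_square_norm)
  have "- 2 * (d \<bullet> d) = 0"
  proof (rule linear_term_eq_0[of _ "l * (d \<bullet> d) - d \<bullet> (K *v d)"])
    fix t
    have "y + t *\<^sub>R d \<in> V" using y \<open>d \<in> V\<close> V by (simp add: subspace_add subspace_scale)
    from max'[OF this]
    have "l + 2 * t * (d \<bullet> (K *v y)) + t * t * (d \<bullet> (K *v d))
        \<le> l + 2 * t * l * (d \<bullet> y) + t * t * l * (d \<bullet> d)"
      using inner_symmetric_matrix[OF sym, of y d] yy
      by (simp add: matrix_vector_right_distrib matrix_vector_mult_scaleR inner_add_left inner_add_right
          algebra_simps l_def[symmetric] inner_commute)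
    moreover have "d \<bullet> (K *v y) = d \<bullet> d + l * (d \<bullet> y)"
      by (simp add: d_def inner_diff_right inner_diff_left algebra_simps)
    ultimately show "0 \<le> t * (- 2 * (d \<bullet> d)) + t\<^sup>2 * (l * (d \<bullet> d) - d \<bullet> (K *v d))"
      by (simp add: algebra_simps power2_eq_square)
  qed
  then have "K *v y = l *\<^sub>R y" by (simp add: d_def)
  with y show ?thesis by (auto simp: V_def)
qed

theorem symmetric_matrix_eigensystem:
  fixes K :: "real^'n^'n"
  assumes sym: "transpose K = K"
  shows "\<exists>v k. eigensystem K v k"
proof -
  define good where "good S \<longleftrightarrow> pairwise orthogonal S \<and> (\<forall>x\<in>S. norm x = 1 \<and> (\<exists>l. K *v x = l *\<^sub>R x))"
    for S :: "(real^'n) set"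
  have good_indep: "finite S \<and> card S \<le> CARD('n)" if "good S" for S
  proof -
    have "independent S"
      by (rule pairwise_orthogonal_independent) (use that in \<open>auto simp: good_def\<close>)
    then show ?thesis using independent_bound[of S] by simp
  qed
  have "good {}" by (simp add: good_def)
  then obtain S where S: "good S" and max: "\<And>T. good T \<Longrightarrow> card T \<le> card S"
    using ex_has_greatest_nat[of good "{}" card "Suc CARD('n)"] good_indep le_imp_less_Suc by metis
  have fin: "finite S" using good_indep S by blast
  have "span S = UNIV"
  proof (rule ccontr)
    assume "span S \<noteq> UNIV"
    then obtain z where z: "z \<noteq> 0" "\<And>x. x \<in> span S \<Longrightarrow> orthogonal z x"
      using orthogonal_to_subspace_exists_gen[of S UNIV] by auto
    obtain y l where y: "norm y = 1" "\<forall>x\<in>S. orthogonal x y" "K *v y = l *\<^sub>R y"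
      using exists_orthogonal_eigenvector[OF sym, of S z] z S
      by (auto simp: good_def span_base orthogonal_commute)
    have "y \<notin> S" using y by (metis norm_eq_1 orthogonal_def zero_neq_one)
    moreover have "good (insert y S)"
      using y S by (auto simp: good_def pairwise_insert orthogonal_commute)
    ultimately show False using max[of "insert y S"] fin by simp
  qed
  then have "card S = CARD('n)"
    using good_indep[OF S] dim_le_card'[OF fin] dim_span[of S] by simp
  then obtain v :: "'n \<Rightarrow> real^'n" where v: "bij_betw v UNIV S"
    using finite_same_card_bij[of "UNIV :: 'n set" S] fin by auto
  have vS: "v i \<in> S" for i using v by (auto simp: bij_betw_def)
  have "\<forall>i. \<exists>l. K *v v i = l *\<^sub>R v i" using vS S by (auto simp: good_def)
  then obtain k where k: "\<And>i. K *v v i = k i *\<^sub>R v i" by metis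
  have "v i \<bullet> v j = (if i = j then 1 else 0)" for i j
  proof (cases "i = j")
    case True then show ?thesis using vS[of i] S by (simp add: good_def norm_eq_1)
  next
    case False
    then have "v i \<noteq> v j" using v by (auto simp: bij_betw_def inj_def)
    then show ?thesis using vS[of i] vS[of j] S False by (auto simp: good_def pairwise_def orthogonal_def)
  qed
  with k have "eigensystem K v k" by (simp add: eigensystem_def)
  then show ?thesis by blast
qed

section \<open>The exponential trace\<close>

text \<open>
  For \<open>0 \<le> t \<le> 1/2\<close> concavity gives \<open>3/4 t \<le> 1 - exp (- t)\<close>, but below \<open>t\<close> is the
  difference of an eigenvalue of \<open>K + W\<close> and one of \<open>K\<close>, which can be any real number. The additional
  terms are negative outside \<open>[0, 1/2]\<close>, and their averages turn out to be nonnegative. Their total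
  weight at 0 is forced by the first derivatives there; the term without \<open>exp (- t)\<close> is
  needed for large \<open>t\<close> and the one with \<open>exp (- t)\<close> for negative \<open>t\<close>.
\<close>

lemma exp_increment_bound:
  fixes t :: real
  shows "3/4 * t + 1/4 * (1 + exp (- t)) * (t/2 - t\<^sup>2) \<le> 1 - exp (- t)"
proof -
  have "1 + t/8 - t\<^sup>2/4 \<le> exp t * (1 - 7/8 * t + t\<^sup>2/4)"
  proof -
    have pos: "0 < 1 - 7/8 * t + t\<^sup>2/4"
    proof -
      have "0 \<le> (t/2 - 7/8)\<^sup>2" by simp
      then show ?thesis by (simp add: power2_diff power_divide field_simps)
    qed
    (* The cubic Taylor polynomial suffices down to about -1.4; the left-hand side is
       negative below -2, and in between constant bounds are enough. *)
    consider "t \<le> -2" | "-2 \<le> t" "t \<le> -139/100" | "-139/100 \<le> t" by linarith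
    then show ?thesis
    proof cases
      case 1
      then have "4 \<le> t\<^sup>2" using abs_le_square_iff[of 2 t] by simp
      then have "1 + t/8 - t\<^sup>2/4 \<le> 0" using 1 by simp
      also have "0 \<le> exp t * (1 - 7/8 * t + t\<^sup>2/4)" using pos by simp
      finally show ?thesis .
    next
      case 2
      have "exp 2 = exp 1 * exp (1::real)" by (simp add: exp_add[symmetric])
      also have "\<dots> \<le> (272/100) * (272/100)"
        by (intro mult_mono less_imp_le[OF e_less_272]) auto
      finally have e: "exp (2::real) \<le> 73984/10000" by simp
      have "(139/100)\<^sup>2 \<le> t\<^sup>2" using 2 abs_le_square_iff[of "139/100" t] by simp
      then have sq: "19321/10000 \<le> t\<^sup>2" by (simp add: power2_eq_square)
      have "1 + t/8 - t\<^sup>2/4 \<le> (10000/73984) * (2699/1000)" using 2 sq by simp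
      also have "\<dots> \<le> exp t * (1 - 7/8 * t + t\<^sup>2/4)"
      proof (rule mult_mono)
        have "10000/73984 \<le> 1 / exp (2::real)" using e by (simp add: field_simps)
        also have "\<dots> = exp (-2)" by (simp add: exp_minus field_simps)
        also have "\<dots> \<le> exp t" using 2 by simp
        finally show "10000/73984 \<le> exp t" .
        show "2699/1000 \<le> 1 - 7/8 * t + t\<^sup>2/4" using 2 sq by simp
      qed auto
      finally show ?thesis .
    next
      case 3
      have nonneg: "0 \<le> 6 - t - t\<^sup>2 + 2 * t^3"
      proof -
        define u where "u = t + 139/100"
        have "0 \<le> u" using 3 by (simp add: u_def)
        (* the expansion at -139/100, whose quadratic factor has no real root *)
        have "6 - t - t\<^sup>2 + 2 * t^3
            = u * (2 * (u - 467/200)\<^sup>2 + 49363/20000) + 43331/500000"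
          by (simp add: u_def field_simps eval_nat_numeral)
        then show ?thesis using \<open>0 \<le> u\<close> by simp
      qed
      obtain s where "exp t = (\<Sum>m<4. t ^ m / fact m) + exp s / fact 4 * t ^ 4"
        using Maclaurin_exp_le[of t 4] by auto
      then have "exp t \<ge> (\<Sum>m<4. t ^ m / fact m)" by simp
      then have "1 + t + t\<^sup>2/2 + t^3/6 \<le> exp t"
        by (simp add: eval_nat_numeral fact_numeral)
      then have "(1 + t + t\<^sup>2/2 + t^3/6) * (1 - 7/8 * t + t\<^sup>2/4) \<le> exp t * (1 - 7/8 * t + t\<^sup>2/4)"
        using pos by (intro mult_right_mono) auto
      moreover have "(1 + t + t\<^sup>2/2 + t^3/6) * (1 - 7/8 * t + t\<^sup>2/4) - (1 + t/8 - t\<^sup>2/4)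
          = t\<^sup>2 * (6 - t - t\<^sup>2 + 2 * t^3) / 48"
        by (simp add: field_simps eval_nat_numeral)
      moreover have "0 \<le> t\<^sup>2 * (6 - t - t\<^sup>2 + 2 * t^3) / 48" using nonneg by simp
      ultimately show ?thesis by linarith
    qed
  qed
  then have "exp (- t) * (1 + t/8 - t\<^sup>2/4) \<le> exp (- t) * (exp t * (1 - 7/8 * t + t\<^sup>2/4))"
    by (rule mult_left_mono) simp
  also have "\<dots> = 1 - 7/8 * t + t\<^sup>2/4" by (simp add: mult.assoc[symmetric] exp_add[symmetric])
  finally show ?thesis by (simp add: field_simps)
qed

text \<open>In Loewner order, \<open>W\<^sup>2 \<le> r W\<close>.\<close>

lemma norm_psd_mult_le:
  assumes W: "psd W" and le: "\<And>x. x \<bullet> (W *v x) \<le> r * (x \<bullet> x)"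
  shows "(W *v x) \<bullet> (W *v x) \<le> r * (x \<bullet> (W *v x))"
proof (cases "W *v x = 0")
  case False
  let ?y = "W *v x"
  have pos: "0 < ?y \<bullet> ?y" using False by simp
  have "(?y \<bullet> ?y)\<^sup>2 = (x \<bullet> (W *v ?y))\<^sup>2"
    by (simp add: inner_symmetric_matrix[OF psd_symmetric[OF W]])
  also have "\<dots> \<le> (x \<bullet> (W *v x)) * (?y \<bullet> (W *v ?y))"
    by (rule psd_Cauchy_Schwarz[OF W])
  also have "\<dots> \<le> (x \<bullet> (W *v x)) * (r * (?y \<bullet> ?y))"
    by (intro mult_left_mono le psd_nonneg[OF W])
  finally show ?thesis using pos by (simp add: power2_eq_square mult.commute)
qed simp

text \<open>
  The one-step inequality. Written in the eigenbases of \<open>K\<close> and \<open>K + W\<close>, the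
  matrix \<open>W\<close> has the entries \<open>(l b - k a) (v a \<bullet> u b)\<close>. Hence all traces that occur here
  are sums over pairs \<open>(a, b)\<close> of a function of \<open>k a\<close> and \<open>l b\<close> with the weights
  \<open>(v a \<bullet> u b)\<^sup>2\<close>, and an inequality between such traces follows from one between
  real numbers, although \<open>K\<close> and \<open>W\<close> need not commute.
  The corrections \<open>t/2 - t\<^sup>2\<close> in the scalar inequality sum up to
  traces of \<open>W/2 - W\<^sup>2\<close> against exponentials of \<open>K\<close> and \<open>K + W\<close>, which are nonnegative.
\<close>

lemma exp_trace_step:
  fixes K W :: "real^'n^'n"
  assumes K: "eigensystem K v k" and sym: "transpose K = K"
    and L: "eigensystem (K + W) u l"
    and W: "psd W" and le: "\<And>x. x \<bullet> (W *v x) \<le> 1/2 * (x \<bullet> x)"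
  shows "(\<Sum>b\<in>UNIV. exp (- l b)) \<le> (\<Sum>a\<in>UNIV. exp (- k a) * (1 - 3/4 * (v a \<bullet> (W *v v a))))"
proof -
  define c where "c a b = (v a \<bullet> u b)\<^sup>2" for a b
  define t where "t a b = l b - k a" for a b
  have c_nonneg: "0 \<le> c a b" for a b by (simp add: c_def)
  have entry: "v a \<bullet> (W *v u b) = t a b * (v a \<bullet> u b)" for a b
  proof -
    have "v a \<bullet> ((K + W) *v u b) = l b * (v a \<bullet> u b)"
      by (simp add: eigensystem_vector[OF L])
    moreover have "v a \<bullet> (K *v u b) = k a * (v a \<bullet> u b)"
      by (simp add: inner_symmetric_matrix[OF sym] eigensystem_vector[OF K])
    ultimately show ?thesis
      by (simp add: t_def matrix_vector_mult_add_rdistrib inner_add_right algebra_simps)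
  qed
  have entry': "(W *v v a) \<bullet> u b = t a b * (v a \<bullet> u b)" for a b
    using entry by (simp add: inner_symmetric_matrix[OF psd_symmetric[OF W]])
  have c1: "(\<Sum>b\<in>UNIV. c a b) = 1" for a
    using eigensystem_inner[OF L, of "v a" "v a"] eigensystem_norm[OF K]
    by (simp add: c_def power2_eq_square)
  have c2: "(\<Sum>a\<in>UNIV. c a b) = 1" for b
    using eigensystem_inner[OF K, of "u b" "u b"] eigensystem_norm[OF L]
    by (simp add: c_def power2_eq_square inner_commute)
  have W1: "v a \<bullet> (W *v v a) = (\<Sum>b\<in>UNIV. c a b * t a b)" for a
    using eigensystem_inner[OF L, of "v a" "W *v v a"]
    by (simp add: entry' c_def power2_eq_square algebra_simps)
  have W2: "(W *v v a) \<bullet> (W *v v a) = (\<Sum>b\<in>UNIV. c a b * (t a b)\<^sup>2)" for a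
    using eigensystem_inner[OF L, of "W *v v a" "W *v v a"]
    by (simp add: entry' c_def power2_eq_square algebra_simps)
  have W3: "u b \<bullet> (W *v u b) = (\<Sum>a\<in>UNIV. c a b * t a b)" for b
    using eigensystem_inner[OF K, of "u b" "W *v u b"]
    by (simp add: entry inner_commute[of _ "v _"] c_def power2_eq_square algebra_simps)
  have W4: "(W *v u b) \<bullet> (W *v u b) = (\<Sum>a\<in>UNIV. c a b * (t a b)\<^sup>2)" for b
    using eigensystem_inner[OF K, of "W *v u b" "W *v u b"]
    by (simp add: entry inner_commute[of _ "v _"] c_def power2_eq_square algebra_simps)
  have pos1: "0 \<le> (\<Sum>b\<in>UNIV. c a b * (t a b / 2 - (t a b)\<^sup>2))" for a
    using norm_psd_mult_le[OF W le, of "v a"]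
    by (simp add: W1 W2 right_diff_distrib sum_subtractf sum_divide_distrib)
  have pos2: "0 \<le> (\<Sum>a\<in>UNIV. c a b * (t a b / 2 - (t a b)\<^sup>2))" for b
    using norm_psd_mult_le[OF W le, of "u b"]
    by (simp add: W3 W4 right_diff_distrib sum_subtractf sum_divide_distrib)
  have "(\<Sum>b\<in>UNIV. exp (- l b)) = (\<Sum>b\<in>UNIV. \<Sum>a\<in>UNIV. c a b * exp (- l b))"
    by (simp add: sum_distrib_right[symmetric] c2)
  also have "\<dots> = (\<Sum>a\<in>UNIV. \<Sum>b\<in>UNIV. c a b * exp (- l b))"
    by (rule sum.swap)
  also have "\<dots> \<le> (\<Sum>a\<in>UNIV. \<Sum>b\<in>UNIV. c a b * (exp (- k a) * (1 - 3/4 * t a b)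
      - 1/4 * (exp (- k a) + exp (- l b)) * (t a b / 2 - (t a b)\<^sup>2)))"
  proof (intro sum_mono mult_left_mono c_nonneg)
    fix a b
    have e: "exp (- k a) * exp (- t a b) = exp (- l b)"
      by (simp add: t_def exp_add[symmetric])
    have "exp (- k a) * (3/4 * t a b + 1/4 * (1 + exp (- t a b)) * (t a b / 2 - (t a b)\<^sup>2))
       \<le> exp (- k a) * (1 - exp (- t a b))"
      by (intro mult_left_mono exp_increment_bound) simp
    moreover have "exp (- k a) * (1 - 3/4 * t a b)
        - 1/4 * (exp (- k a) + exp (- l b)) * (t a b / 2 - (t a b)\<^sup>2) - exp (- l b)
      = exp (- k a) * (1 - exp (- t a b))
        - exp (- k a) * (3/4 * t a b + 1/4 * (1 + exp (- t a b)) * (t a b / 2 - (t a b)\<^sup>2))"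
      unfolding e[symmetric] by (simp add: field_simps)
    ultimately show "exp (- l b) \<le> exp (- k a) * (1 - 3/4 * t a b)
      - 1/4 * (exp (- k a) + exp (- l b)) * (t a b / 2 - (t a b)\<^sup>2)"
      by linarith
  qed
  also have "\<dots> = (\<Sum>a\<in>UNIV. exp (- k a) * (\<Sum>b\<in>UNIV. c a b * (1 - 3/4 * t a b)))
      - 1/4 * ((\<Sum>a\<in>UNIV. exp (- k a) * (\<Sum>b\<in>UNIV. c a b * (t a b / 2 - (t a b)\<^sup>2)))
        + (\<Sum>a\<in>UNIV. \<Sum>b\<in>UNIV. exp (- l b) * (c a b * (t a b / 2 - (t a b)\<^sup>2))))"
    by (simp only: sum_distrib_left sum_subtractf[symmetric] sum.distrib[symmetric])
       (simp add: algebra_simps)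
  also have "(\<Sum>a\<in>UNIV. \<Sum>b\<in>UNIV. exp (- l b) * (c a b * (t a b / 2 - (t a b)\<^sup>2)))
      = (\<Sum>b\<in>UNIV. exp (- l b) * (\<Sum>a\<in>UNIV. c a b * (t a b / 2 - (t a b)\<^sup>2)))"
    by (subst sum.swap) (simp add: sum_distrib_left)
  also have "(\<Sum>a\<in>UNIV. exp (- k a) * (\<Sum>b\<in>UNIV. c a b * (1 - 3/4 * t a b)))
      = (\<Sum>a\<in>UNIV. exp (- k a) * (1 - 3/4 * (v a \<bullet> (W *v v a))))"
    by (intro sum.cong refl arg_cong2[where f="(*)"])
       (simp add: W1 right_diff_distrib sum_subtractf c1 sum_distrib_left mult.left_commute)
  finally have bound: "(\<Sum>b\<in>UNIV. exp (- l b)) \<le>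
      (\<Sum>a\<in>UNIV. exp (- k a) * (1 - 3/4 * (v a \<bullet> (W *v v a))))
      - 1/4 * ((\<Sum>a\<in>UNIV. exp (- k a) * (\<Sum>b\<in>UNIV. c a b * (t a b / 2 - (t a b)\<^sup>2)))
        + (\<Sum>b\<in>UNIV. exp (- l b) * (\<Sum>a\<in>UNIV. c a b * (t a b / 2 - (t a b)\<^sup>2))))" .
  have "0 \<le> (\<Sum>a\<in>UNIV. exp (- k a) * (\<Sum>b\<in>UNIV. c a b * (t a b / 2 - (t a b)\<^sup>2)))"
    by (intro sum_nonneg mult_nonneg_nonneg pos1) simp
  moreover have "0 \<le> (\<Sum>b\<in>UNIV. exp (- l b) * (\<Sum>a\<in>UNIV. c a b * (t a b / 2 - (t a b)\<^sup>2)))"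
    by (intro sum_nonneg mult_nonneg_nonneg pos2) simp
  ultimately show ?thesis using bound by argo
qed

text \<open>
  The trace of \<open>exp (- K)\<close> for a symmetric matrix \<open>K\<close>, written with a chosen list of eigenvalues
  so that no matrix exponential has to be constructed.
\<close>

definition trace_exp_neg :: "real^'n^'n \<Rightarrow> real" where
  "trace_exp_neg K = (\<Sum>i\<in>UNIV. exp (- (SOME k. \<exists>v. eigensystem K v k) i))"

lemma trace_exp_neg_eigensystem:
  fixes K :: "real^'n^'n"
  assumes "transpose K = K"
  obtains v k where "eigensystem K v k" "trace_exp_neg K = (\<Sum>i\<in>UNIV. exp (- k i))"
proof -
  have "\<exists>k v. eigensystem K v k" using symmetric_matrix_eigensystem[OF assms] by blast
  from someI_ex[OF this] show ?thesis using that by (auto simp: trace_exp_neg_def)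
qed

lemma trace_exp_neg_nonneg: "0 \<le> trace_exp_neg K"
  by (simp add: trace_exp_neg_def sum_nonneg)

lemma trace_exp_neg_0: "trace_exp_neg (0 :: real^'n^'n) = real CARD('n)"
proof -
  have "transpose (0 :: real^'n^'n) = 0" by (simp add: transpose_def vec_eq_iff)
  then obtain v k where vk: "eigensystem (0 :: real^'n^'n) v k"
      "trace_exp_neg (0 :: real^'n^'n) = (\<Sum>i\<in>UNIV. exp (- k i))"
    using trace_exp_neg_eigensystem by blast
  have "k i = 0" for i
    using eigensystem_vector[OF vk(1), of i] eigensystem_norm[OF vk(1), of i] by auto
  then show ?thesis by (simp add: vk)
qed

lemma exp_neg_le_trace_exp_neg:
  fixes K :: "real^'n^'n"
  assumes sym: "transpose K = K" and x: "x \<bullet> (K *v x) < \<tau> * (x \<bullet> x)"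
  shows "exp (- \<tau>) \<le> trace_exp_neg K"
proof -
  obtain v k where vk: "eigensystem K v k" "trace_exp_neg K = (\<Sum>i\<in>UNIV. exp (- k i))"
    using trace_exp_neg_eigensystem[OF sym] by blast
  have "\<exists>i. k i < \<tau>"
  proof (rule ccontr)
    assume "\<nexists>i. k i < \<tau>"
    then have k: "\<tau> \<le> k i" for i by (simp add: not_less)
    have "(K *v x) \<bullet> v i = k i * (x \<bullet> v i)" for i
      using inner_symmetric_matrix[OF sym, of x "v i"] eigensystem_vector[OF vk(1)] by simp
    then have "x \<bullet> (K *v x) = (\<Sum>i\<in>UNIV. k i * (x \<bullet> v i)\<^sup>2)"
      using eigensystem_inner[OF vk(1), of x "K *v x"] by (simp add: power2_eq_square algebra_simps)
    also have "\<dots> \<ge> (\<Sum>i\<in>UNIV. \<tau> * (x \<bullet> v i)\<^sup>2)"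
      by (intro sum_mono mult_right_mono k) simp
    also have "(\<Sum>i\<in>UNIV. \<tau> * (x \<bullet> v i)\<^sup>2) = \<tau> * (x \<bullet> x)"
      using eigensystem_inner[OF vk(1), of x x] by (simp add: power2_eq_square sum_distrib_left)
    finally show False using x by simp
  qed
  then obtain i where "k i < \<tau>" by blast
  then have "exp (- \<tau>) \<le> exp (- k i)" by simp
  also have "\<dots> \<le> trace_exp_neg K"
    unfolding vk(2) by (rule member_le_sum) auto
  finally show ?thesis .
qed

section \<open>A lower tail bound for sums of independent random matrices\<close>

text \<open>
  As \<open>exp_trace_step\<close> is linear in \<open>W\<close> for a fixed eigenbasis of \<open>K\<close>, the lower bound on the
  mean of \<open>W\<close> can be applied to each eigenvector.
\<close>

lemma expected_trace_exp_neg_step: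
  fixes K :: "real^'n^'n" and D :: "'s::finite pmf" and W :: "'s \<Rightarrow> real^'n^'n"
  assumes sym: "transpose K = K"
    and W: "\<And>s. psd (W s)" and le: "\<And>s x. x \<bullet> (W s *v x) \<le> 1/2 * (x \<bullet> x)"
    and mean: "\<And>x. \<mu> * (x \<bullet> x) \<le> (\<Sum>s\<in>UNIV. pmf D s * (x \<bullet> (W s *v x)))"
  shows "(\<Sum>s\<in>UNIV. pmf D s * trace_exp_neg (K + W s)) \<le> (1 - 3/4 * \<mu>) * trace_exp_neg K"
proof -
  obtain v k where vk: "eigensystem K v k" "trace_exp_neg K = (\<Sum>i\<in>UNIV. exp (- k i))"
    using trace_exp_neg_eigensystem[OF sym] by blast
  have step: "trace_exp_neg (K + W s) \<le> (\<Sum>a\<in>UNIV. exp (- k a) * (1 - 3/4 * (v a \<bullet> (W s *v v a))))" for s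
  proof -
    have "transpose (K + W s) = K + W s"
      by (simp add: transpose_add sym psd_symmetric[OF W])
    then obtain u l where "eigensystem (K + W s) u l" "trace_exp_neg (K + W s) = (\<Sum>i\<in>UNIV. exp (- l i))"
      using trace_exp_neg_eigensystem by blast
    then show ?thesis using exp_trace_step[OF vk(1) sym _ W le] by simp
  qed
  have one: "(\<Sum>s\<in>UNIV. pmf D s) = 1" by (simp add: sum_pmf_eq_1)
  have "(\<Sum>s\<in>UNIV. pmf D s * trace_exp_neg (K + W s))
      \<le> (\<Sum>s\<in>UNIV. pmf D s * (\<Sum>a\<in>UNIV. exp (- k a) * (1 - 3/4 * (v a \<bullet> (W s *v v a)))))"
    by (intro sum_mono mult_left_mono step) simp
  also have "\<dots> = (\<Sum>a\<in>UNIV. \<Sum>s\<in>UNIV. exp (- k a) * (pmf D s - 3/4 * (pmf D s * (v a \<bullet> (W s *v v a)))))"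
    by (subst sum.swap) (simp add: sum_distrib_left algebra_simps)
  also have "\<dots> = (\<Sum>a\<in>UNIV. exp (- k a) * (1 - 3/4 * (\<Sum>s\<in>UNIV. pmf D s * (v a \<bullet> (W s *v v a)))))"
    by (simp only: sum_distrib_left[symmetric] sum_subtractf one)
  also have "\<dots> \<le> (\<Sum>a\<in>UNIV. exp (- k a) * (1 - 3/4 * \<mu>))"
    using mean[of "v _"] eigensystem_norm[OF vk(1)] by (intro sum_mono mult_left_mono) auto
  also have "\<dots> = (1 - 3/4 * \<mu>) * trace_exp_neg K"
    unfolding vk(2) sum_distrib_left by (rule sum.cong) (simp_all only: mult.commute)
  finally show ?thesis .
qed

lemma sum_PiE_insert:
  fixes g :: "('i \<Rightarrow> 's) \<Rightarrow> real"
  assumes "i \<notin> I"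
  shows "(\<Sum>f\<in>PiE (insert i I) (\<lambda>_. S). g f) = (\<Sum>f\<in>PiE I (\<lambda>_. S). \<Sum>s\<in>S. g (f(i := s)))"
proof -
  have "(\<Sum>f\<in>PiE (insert i I) (\<lambda>_. S). g f) = (\<Sum>(s, f)\<in>S \<times> PiE I (\<lambda>_. S). g (f(i := s)))"
    unfolding PiE_insert_eq
    by (subst sum.reindex[OF inj_combinator[OF assms]]) (simp add: case_prod_unfold)
  also have "\<dots> = (\<Sum>s\<in>S. \<Sum>f\<in>PiE I (\<lambda>_. S). g (f(i := s)))"
    by (simp add: sum.cartesian_product)
  finally show ?thesis by (subst sum.swap)
qed

lemma expected_trace_exp_neg_sum:
  fixes D :: "'s::finite pmf" and W :: "'s \<Rightarrow> real^'n^'n"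
  assumes I: "finite I"
    and W: "\<And>s. psd (W s)" and le: "\<And>s x. x \<bullet> (W s *v x) \<le> 1/2 * (x \<bullet> x)"
    and mean: "\<And>x. \<mu> * (x \<bullet> x) \<le> (\<Sum>s\<in>UNIV. pmf D s * (x \<bullet> (W s *v x)))"
    and \<mu>: "3/4 * \<mu> \<le> 1"
  shows "(\<Sum>f\<in>PiE I (\<lambda>_. UNIV). (\<Prod>j\<in>I. pmf D (f j)) * trace_exp_neg (\<Sum>j\<in>I. W (f j)))
      \<le> (1 - 3/4 * \<mu>) ^ card I * real CARD('n)"
  using I
proof (induction I rule: finite_induct)
  case empty
  show ?case by (simp add: trace_exp_neg_0)
next
  case (insert i I)
  have "(\<Sum>f\<in>PiE (insert i I) (\<lambda>_. UNIV). (\<Prod>j\<in>insert i I. pmf D (f j)) * trace_exp_neg (\<Sum>j\<in>insert i I. W (f j)))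
     = (\<Sum>f\<in>PiE I (\<lambda>_. UNIV). \<Sum>s\<in>UNIV. (pmf D s * (\<Prod>j\<in>I. pmf D (f j))) * trace_exp_neg (W s + (\<Sum>j\<in>I. W (f j))))"
    unfolding sum_PiE_insert[OF insert.hyps(2)]
  proof (intro sum.cong refl)
    fix f :: "_ \<Rightarrow> 's" and s
    have "(\<Prod>j\<in>I. pmf D ((f(i := s)) j)) = (\<Prod>j\<in>I. pmf D (f j))"
      "(\<Sum>j\<in>I. W ((f(i := s)) j)) = (\<Sum>j\<in>I. W (f j))"
      using insert.hyps(2) by (auto intro!: sum.cong prod.cong)
    then show "(\<Prod>j\<in>insert i I. pmf D ((f(i := s)) j)) * trace_exp_neg (\<Sum>j\<in>insert i I. W ((f(i := s)) j))
      = (pmf D s * (\<Prod>j\<in>I. pmf D (f j))) * trace_exp_neg (W s + (\<Sum>j\<in>I. W (f j)))"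
      using insert.hyps by simp
  qed
  also have "\<dots> = (\<Sum>f\<in>PiE I (\<lambda>_. UNIV). (\<Prod>j\<in>I. pmf D (f j)) *
      (\<Sum>s\<in>UNIV. pmf D s * trace_exp_neg ((\<Sum>j\<in>I. W (f j)) + W s)))"
    by (simp add: sum_distrib_left mult_ac add.commute)
  also have "\<dots> \<le> (\<Sum>f\<in>PiE I (\<lambda>_. UNIV). (\<Prod>j\<in>I. pmf D (f j)) *
      ((1 - 3/4 * \<mu>) * trace_exp_neg (\<Sum>j\<in>I. W (f j))))"
    by (intro sum_mono mult_left_mono expected_trace_exp_neg_step W le mean prod_nonneg)
       (simp_all add: transpose_sum psd_symmetric[OF W])
  also have "\<dots> = (1 - 3/4 * \<mu>) *
      (\<Sum>f\<in>PiE I (\<lambda>_. UNIV). (\<Prod>j\<in>I. pmf D (f j)) * trace_exp_neg (\<Sum>j\<in>I. W (f j)))"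
    by (simp add: sum_distrib_left mult_ac)
  also have "\<dots> \<le> (1 - 3/4 * \<mu>) * ((1 - 3/4 * \<mu>) ^ card I * real CARD('n))"
    by (intro mult_left_mono insert.IH) (use \<mu> in simp)
  finally show ?case using insert.hyps by (simp add: mult.assoc)
qed

text \<open>
  Events of finitely many independent random variables with values in a finite type are finite
  disjoint unions of elementary events, so that their measurability is automatic and their
  probabilities are finite sums.
\<close>

lemma prob_indep_finite:
  fixes D :: "'s::finite pmf" and X :: "'i \<Rightarrow> 'w \<Rightarrow> 's"
  assumes M: "prob_space M" and I: "finite I" "I \<noteq> {}"
    and indep: "prob_space.indep_vars M (\<lambda>_. count_space UNIV) X I"
    and sample: "\<And>j. j \<in> I \<Longrightarrow> distr M (count_space UNIV) (X j) = measure_pmf D"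
  shows "{\<omega> \<in> space M. Q (\<lambda>j\<in>I. X j \<omega>)} \<in> sets M"
    and "measure M {\<omega> \<in> space M. Q (\<lambda>j\<in>I. X j \<omega>)}
      = (\<Sum>f\<in>PiE I (\<lambda>_. UNIV). if Q f then (\<Prod>j\<in>I. pmf D (f j)) else 0)"
proof -
  interpret prob_space M by fact
  have meas: "X j \<in> measurable M (count_space UNIV)" if "j \<in> I" for j
    using indep that by (simp add: indep_vars_def)
  define E where "E f = (\<Inter>j\<in>I. X j -` {f j} \<inter> space M)" for f
  have E_sets: "E f \<in> sets M" for f
    unfolding E_def using I meas by (intro sets.finite_INT) (auto intro!: measurable_sets)
  have fin: "finite (PiE I (\<lambda>_. UNIV :: 's set))" by (intro finite_PiE I) auto
  have E_prob: "prob (E f) = (\<Prod>j\<in>I. pmf D (f j))" for f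
  proof -
    have "prob (E f) = (\<Prod>j\<in>I. prob (X j -` {f j} \<inter> space M))"
      unfolding E_def using indep_varsD_finite[OF indep I(2) I(1), of "\<lambda>j. {f j}"] by simp
    also have "\<dots> = (\<Prod>j\<in>I. pmf D (f j))"
    proof (rule prod.cong[OF refl])
      fix j assume "j \<in> I"
      have "prob (X j -` {f j} \<inter> space M) = measure (distr M (count_space UNIV) (X j)) {f j}"
        using meas[OF \<open>j \<in> I\<close>] by (simp add: measure_distr)
      then show "prob (X j -` {f j} \<inter> space M) = pmf D (f j)"
        by (simp add: sample[OF \<open>j \<in> I\<close>] pmf.rep_eq)
    qed
    finally show ?thesis .
  qed
  have E_iff: "\<omega> \<in> E f \<longleftrightarrow> \<omega> \<in> space M \<and> (\<lambda>j\<in>I. X j \<omega>) = f" if "f \<in> PiE I (\<lambda>_. UNIV)" for f \<omega>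
  proof -
    have "(\<lambda>j\<in>I. X j \<omega>) = f \<longleftrightarrow> (\<forall>j\<in>I. X j \<omega> = f j)"
      using that by (auto simp: fun_eq_iff PiE_def extensional_def restrict_def)
    then show ?thesis using I by (auto simp: E_def)
  qed
  have dec: "{\<omega> \<in> space M. Q (\<lambda>j\<in>I. X j \<omega>)} = (\<Union>f\<in>{f \<in> PiE I (\<lambda>_. UNIV). Q f}. E f)"
    by (auto simp: E_iff)
  show "{\<omega> \<in> space M. Q (\<lambda>j\<in>I. X j \<omega>)} \<in> sets M"
    unfolding dec using fin E_sets by (intro sets.finite_UN) auto
  have "prob (\<Union>f\<in>{f \<in> PiE I (\<lambda>_. UNIV). Q f}. E f) = (\<Sum>f\<in>{f \<in> PiE I (\<lambda>_. UNIV). Q f}. prob (E f))"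
  proof (rule finite_measure_finite_Union)
    show "disjoint_family_on E {f \<in> PiE I (\<lambda>_. UNIV). Q f}"
      by (auto simp: disjoint_family_on_def E_iff)
  qed (use fin E_sets in auto)
  then show "prob {\<omega> \<in> space M. Q (\<lambda>j\<in>I. X j \<omega>)}
      = (\<Sum>f\<in>PiE I (\<lambda>_. UNIV). if Q f then (\<Prod>j\<in>I. pmf D (f j)) else 0)"
    unfolding dec E_prob using fin by (simp add: sum.inter_filter)
qed

text \<open>
  A lower matrix Chernoff bound: Markov's inequality for the exponential trace, which
  exceeds \<open>exp (- \<tau>)\<close> as soon as some eigenvalue of the sum is less than \<open>\<tau>\<close>.
\<close>

theorem matrix_Chernoff_lower:
  fixes D :: "'s::finite pmf" and W :: "'s \<Rightarrow> real^'n^'n" and X :: "'i \<Rightarrow> 'w \<Rightarrow> 's"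
  assumes M: "prob_space M" and I: "finite I" "I \<noteq> {}"
    and indep: "prob_space.indep_vars M (\<lambda>_. count_space UNIV) X I"
    and sample: "\<And>j. j \<in> I \<Longrightarrow> distr M (count_space UNIV) (X j) = measure_pmf D"
    and W: "\<And>s. psd (W s)" and le: "\<And>s x. x \<bullet> (W s *v x) \<le> 1/2 * (x \<bullet> x)"
    and mean: "\<And>x. \<mu> * (x \<bullet> x) \<le> (\<Sum>s\<in>UNIV. pmf D s * (x \<bullet> (W s *v x)))"
  shows "measure M {\<omega> \<in> space M. \<exists>x. x \<bullet> ((\<Sum>j\<in>I. W (X j \<omega>)) *v x) < \<tau> * (x \<bullet> x)}
      \<le> real CARD('n) * exp (\<tau> - 3/4 * \<mu> * real (card I))"
proof -
  define Q where "Q f \<longleftrightarrow> (\<exists>x. x \<bullet> ((\<Sum>j\<in>I. W (f j)) *v x) < \<tau> * (x \<bullet> x))" for f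
  (* the base of the power below has to be nonnegative *)
  have \<mu>: "3/4 * \<mu> \<le> 1"
  proof -
    obtain x :: "real^'n" where "norm x = 1" using vector_choose_size[of 1] by auto
    then have x: "x \<bullet> x = 1" by (simp add: norm_eq_1)
    have "\<mu> \<le> (\<Sum>s\<in>UNIV. pmf D s * (x \<bullet> (W s *v x)))" using mean[of x] x by simp
    also have "\<dots> \<le> (\<Sum>s\<in>UNIV. pmf D s * (1/2))"
      using le[of x] x by (intro sum_mono mult_left_mono) auto
    also have "\<dots> = 1/2" by (simp add: sum_divide_distrib[symmetric] sum_pmf_eq_1)
    finally show ?thesis by simp
  qed
  have "{\<omega> \<in> space M. \<exists>x. x \<bullet> ((\<Sum>j\<in>I. W (X j \<omega>)) *v x) < \<tau> * (x \<bullet> x)}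
      = {\<omega> \<in> space M. Q (\<lambda>j\<in>I. X j \<omega>)}"
    by (simp add: Q_def)
  then have "measure M {\<omega> \<in> space M. \<exists>x. x \<bullet> ((\<Sum>j\<in>I. W (X j \<omega>)) *v x) < \<tau> * (x \<bullet> x)}
      = (\<Sum>f\<in>PiE I (\<lambda>_. UNIV). if Q f then (\<Prod>j\<in>I. pmf D (f j)) else 0)"
    using prob_indep_finite(2)[OF M I indep sample, of Q] by simp
  also have "\<dots> \<le> (\<Sum>f\<in>PiE I (\<lambda>_. UNIV). exp \<tau> * ((\<Prod>j\<in>I. pmf D (f j)) * trace_exp_neg (\<Sum>j\<in>I. W (f j))))"
  proof (rule sum_mono)
    fix f :: "'i \<Rightarrow> 's"
    have p: "0 \<le> (\<Prod>j\<in>I. pmf D (f j))" by (simp add: prod_nonneg)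
    show "(if Q f then (\<Prod>j\<in>I. pmf D (f j)) else 0)
      \<le> exp \<tau> * ((\<Prod>j\<in>I. pmf D (f j)) * trace_exp_neg (\<Sum>j\<in>I. W (f j)))"
    proof (cases "Q f")
      case True
      then obtain x where "x \<bullet> ((\<Sum>j\<in>I. W (f j)) *v x) < \<tau> * (x \<bullet> x)" by (auto simp: Q_def)
      then have "exp (- \<tau>) \<le> trace_exp_neg (\<Sum>j\<in>I. W (f j))"
        by (rule exp_neg_le_trace_exp_neg[rotated]) (simp add: transpose_sum psd_symmetric[OF W])
      then have "exp \<tau> * exp (- \<tau>) \<le> exp \<tau> * trace_exp_neg (\<Sum>j\<in>I. W (f j))"
        by (rule mult_left_mono) simp
      then have "1 \<le> exp \<tau> * trace_exp_neg (\<Sum>j\<in>I. W (f j))" by (simp add: exp_add[symmetric])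
      from mult_left_mono[OF this p] show ?thesis using True by (simp add: mult_ac)
    qed (simp add: p trace_exp_neg_nonneg)
  qed
  also have "\<dots> = exp \<tau> * (\<Sum>f\<in>PiE I (\<lambda>_. UNIV). (\<Prod>j\<in>I. pmf D (f j)) * trace_exp_neg (\<Sum>j\<in>I. W (f j)))"
    by (simp add: sum_distrib_left)
  also have "\<dots> \<le> exp \<tau> * ((1 - 3/4 * \<mu>) ^ card I * real CARD('n))"
    by (intro mult_left_mono expected_trace_exp_neg_sum I W le mean \<mu>) simp
  also have "\<dots> \<le> exp \<tau> * (exp (- (3/4 * \<mu>)) ^ card I * real CARD('n))"
    using \<mu> exp_ge_add_one_self[of "- (3/4 * \<mu>)"]
    by (intro mult_left_mono mult_right_mono power_mono) auto
  also have "\<dots> = real CARD('n) * exp (\<tau> - 3/4 * \<mu> * real (card I))"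
  proof -
    have "exp (\<tau> - 3/4 * \<mu> * real (card I)) = exp \<tau> * exp (real (card I) * - (3/4 * \<mu>))"
      by (subst exp_add[symmetric]) (simp add: mult.commute)
    then show ?thesis by (simp only: exp_of_nat_mult mult_ac)
  qed
  finally show ?thesis .
qed

section \<open>Functions of a symmetric matrix\<close>

definition spectral_matrix :: "('n \<Rightarrow> real^'n) \<Rightarrow> ('n \<Rightarrow> real) \<Rightarrow> real^'n^'n" where
  "spectral_matrix v f = (\<chi> a b. \<Sum>i\<in>UNIV. f i * v i $ a * v i $ b)"

lemma spectral_matrix_vector: "spectral_matrix v f *v x = (\<Sum>i\<in>UNIV. (f i * (x \<bullet> v i)) *\<^sub>R v i)"
proof -
  have "(\<Sum>b\<in>UNIV. (\<Sum>i\<in>UNIV. f i * v i $ a * v i $ b) * x $ b)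
      = (\<Sum>i\<in>UNIV. f i * (\<Sum>b\<in>UNIV. x $ b * v i $ b) * v i $ a)" for a
    unfolding sum_distrib_right sum_distrib_left
    by (subst sum.swap) (simp add: mult_ac)
  then show ?thesis
    by (simp add: vec_eq_iff matrix_vector_mult_def spectral_matrix_def inner_vec_def)
qed

lemma transpose_spectral_matrix: "transpose (spectral_matrix v f) = spectral_matrix v f"
  by (simp add: spectral_matrix_def transpose_def vec_eq_iff mult_ac)

lemma inner_spectral_matrix:
  assumes "eigensystem K v k"
  shows "(spectral_matrix v f *v x) \<bullet> v i = f i * (x \<bullet> v i)"
proof -
  have v: "v j \<bullet> v i = (if j = i then 1 else 0)" for j using assms by (simp add: eigensystem_def)
  show ?thesis by (simp add: spectral_matrix_vector inner_sum_left v if_distrib cong: if_cong)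
qed

lemma spectral_matrix_mult_vector:
  assumes "eigensystem K v k"
  shows "spectral_matrix v f *v (spectral_matrix v g *v x) = spectral_matrix v (\<lambda>i. f i * g i) *v x"
  by (simp add: spectral_matrix_vector[of v f] inner_spectral_matrix[OF assms])
     (simp add: spectral_matrix_vector mult.assoc)

lemma spectral_matrix_mult:
  assumes "eigensystem K v k"
  shows "spectral_matrix v f ** spectral_matrix v g = spectral_matrix v (\<lambda>i. f i * g i)"
  unfolding matrix_eq
  by (simp add: matrix_vector_mul_assoc[symmetric] spectral_matrix_mult_vector[OF assms])

lemma eigensystem_spectral_matrix:
  assumes "eigensystem K v k"
  shows "K = spectral_matrix v k"
  unfolding matrix_eq
proof
  fix x
  have "K *v x = K *v (\<Sum>i\<in>UNIV. (x \<bullet> v i) *\<^sub>R v i)"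
    using eigensystem_expand[OF assms, of x] by simp
  also have "\<dots> = (\<Sum>i\<in>UNIV. (x \<bullet> v i) *\<^sub>R (K *v v i))"
    by (simp add: linear_sum[OF matrix_vector_mul_linear] matrix_vector_mult_scaleR)
  finally show "K *v x = spectral_matrix v k *v x"
    by (simp add: eigensystem_vector[OF assms] spectral_matrix_vector mult.commute)
qed

section \<open>The Moore-Penrose pseudoinverse\<close>

lemma is_pinv_unique:
  assumes X: "is_pinv M X" and Y: "is_pinv M Y"
  shows "X = Y"
proof -
  have l: "M ** X = M ** Y" if "is_pinv M X" "is_pinv M Y" for X Y
  proof -
    have "M ** X = transpose ((M ** Y ** M) ** X)" using that by (simp add: is_pinv_def)
    also have "\<dots> = transpose (M ** X) ** transpose (M ** Y)"
      by (simp add: matrix_transpose_mul matrix_mul_assoc)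
    also have "\<dots> = (M ** X ** M) ** Y" using that by (simp add: is_pinv_def matrix_mul_assoc)
    also have "\<dots> = M ** Y" using that by (simp add: is_pinv_def)
    finally show ?thesis .
  qed
  have r: "X ** M = Y ** M"
  proof -
    have "X ** M = transpose (X ** (M ** Y ** M))" using X Y by (simp add: is_pinv_def)
    also have "\<dots> = transpose (Y ** M) ** transpose (X ** M)"
      by (simp add: matrix_transpose_mul matrix_mul_assoc)
    also have "\<dots> = (Y ** M) ** (X ** M)" using X Y by (simp only: is_pinv_def)
    also have "\<dots> = Y ** (M ** X ** M)" by (simp only: matrix_mul_assoc)
    also have "\<dots> = Y ** M" using X by (simp add: is_pinv_def)
    finally show ?thesis .
  qed
  have "X = X ** M ** X" using X by (simp add: is_pinv_def)
  also have "\<dots> = Y ** (M ** X)" by (simp add: r matrix_mul_assoc)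
  also have "\<dots> = Y ** M ** Y" by (simp add: l[OF X Y] matrix_mul_assoc)
  also have "\<dots> = Y" using Y by (simp add: is_pinv_def)
  finally show ?thesis .
qed

text \<open>
  Inverting the eigenvalues gives the pseudoinverse of a symmetric matrix; the convention
  \<open>inverse 0 = 0\<close> treats the kernel as the Penrose equations require.
\<close>

lemma is_pinv_pinv_symmetric:
  assumes "transpose P = P"
  shows "is_pinv P (pinv P)"
proof -
  obtain v k where vk: "eigensystem P v k" using symmetric_matrix_eigensystem[OF assms] by blast
  have inv: "k i * inverse (k i) * k i = k i" "inverse (k i) * k i * inverse (k i) = inverse (k i)" for i
    by (cases "k i = 0"; simp)+
  have "is_pinv P (spectral_matrix v (\<lambda>i. inverse (k i)))"
    unfolding is_pinv_def eigensystem_spectral_matrix[OF vk]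
    by (simp add: spectral_matrix_mult[OF vk] transpose_spectral_matrix inv)
  then show ?thesis
    unfolding pinv_def by (metis is_pinv_unique theI)
qed

text \<open>
  On its range, a positive semidefinite matrix is bounded from below by the reciprocal of
  the norm of its pseudoinverse. Every vector splits into a part \<open>y\<close> in the range and a part
  in the kernel.
\<close>

lemma psd_range_lower_bound:
  assumes P: "psd P"
  obtains y where "P *v (x - y) = 0" "y \<bullet> y \<le> spectral_norm (pinv P) * (y \<bullet> (P *v y))"
proof
  define X where "X = pinv P"
  define y where "y = P *v (X *v x)"
  have sym: "transpose P = P" by (rule psd_symmetric[OF P])
  have X: "P ** X ** P = P" "transpose (P ** X) = P ** X"
    using is_pinv_pinv_symmetric[OF sym] by (simp_all add: is_pinv_def X_def)
  have "P ** (P ** X) = P ** transpose (P ** X)" by (simp add: X)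
  also have "\<dots> = transpose (P ** X ** P)"
    by (simp only: matrix_transpose_mul sym matrix_mul_assoc)
  finally have "P ** (P ** X) = P" by (simp add: X sym)
  then have "P *v y = P *v x" by (simp add: y_def matrix_vector_mul_assoc)
  then show "P *v (x - y) = 0" by (simp add: matrix_vector_mult_diff_distrib)
  have PXy: "P *v (X *v y) = y"
    by (simp add: y_def matrix_vector_mul_assoc matrix_mul_assoc X)
  have "(y \<bullet> y)\<^sup>2 = (y \<bullet> (P *v (X *v y)))\<^sup>2" by (simp add: PXy)
  also have "\<dots> \<le> (y \<bullet> (P *v y)) * ((X *v y) \<bullet> (P *v (X *v y)))"
    by (rule psd_Cauchy_Schwarz[OF P])
  also have "\<dots> \<le> (y \<bullet> (P *v y)) * (spectral_norm X * (y \<bullet> y))"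
  proof (rule mult_left_mono[OF _ psd_nonneg[OF P]])
    have "(X *v y) \<bullet> y \<le> norm (X *v y) * norm y" by (rule norm_cauchy_schwarz)
    also have "\<dots> \<le> (spectral_norm X * norm y) * norm y"
      unfolding spectral_norm_def
      by (intro mult_right_mono onorm linear_linear[THEN iffD2] matrix_vector_mul_linear) simp
    finally show "(X *v y) \<bullet> (P *v (X *v y)) \<le> spectral_norm X * (y \<bullet> y)"
      by (simp add: PXy dot_square_norm power2_eq_square mult.assoc)
  qed
  finally have sq: "(y \<bullet> y)\<^sup>2 \<le> (y \<bullet> (P *v y)) * (spectral_norm X * (y \<bullet> y))" .
  show "y \<bullet> y \<le> spectral_norm (pinv P) * (y \<bullet> (P *v y))"
  proof (cases "y = 0")
    case False
    then have "0 < y \<bullet> y" by simp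
    with sq show ?thesis by (simp add: power2_eq_square X_def mult_ac)
  qed simp
qed

section \<open>Concentration relative to a positive semidefinite matrix\<close>

lemma psd_null_vector:
  assumes W: "psd W" and y: "y \<bullet> (W *v y) \<le> 0"
  shows "W *v y = 0"
proof -
  have "y \<bullet> (W *v y) = 0" using y psd_nonneg[OF W, of y] by simp
  then have "((W *v y) \<bullet> (W *v y))\<^sup>2 \<le> 0"
    using psd_Cauchy_Schwarz[OF W, of "W *v y" y] by simp
  then show ?thesis by simp
qed

lemma psd_quadratic_form_mod_kernel:
  assumes W: "psd W" and "W *v (x - y) = 0"
  shows "x \<bullet> (W *v x) = y \<bullet> (W *v y)"
proof -
  have "W *v x = W *v y" using assms by (simp add: matrix_vector_mult_diff_distrib)
  then show ?thesis
    using inner_symmetric_matrix[OF psd_symmetric[OF W]] by (metis inner_commute)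
qed

text \<open>
  The Chernoff bound above needs an expectation that is at least a multiple of the identity.
  With \<open>T\<close> the inverse square root of \<open>P\<close> on its range, the matrices \<open>T Y T\<close> are
  bounded by \<open>R I\<close>, but they vanish on the kernel of \<open>P\<close>. There, the projection \<open>Q\<close> onto the
  kernel is added; it contributes nothing for the vectors \<open>z = P\<^sup>1\<^sup>/\<^sup>2 x\<close>, for which the
  conclusion about \<open>T Y T\<close> becomes the one about \<open>Y\<close>.
\<close>

theorem matrix_Chernoff_lower_relative:
  fixes D :: "'s::finite pmf" and Y :: "'s \<Rightarrow> real^'n^'n" and X :: "'i \<Rightarrow> 'w \<Rightarrow> 's"
  assumes M: "prob_space M" and I: "finite I" "I \<noteq> {}"
    and indep: "prob_space.indep_vars M (\<lambda>_. count_space UNIV) X I"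
    and sample: "\<And>j. j \<in> I \<Longrightarrow> distr M (count_space UNIV) (X j) = measure_pmf D"
    and P: "psd P" and Y: "\<And>s. psd (Y s)"
    and R: "0 < R" "\<mu> \<le> R"
    and le: "\<And>s x. x \<bullet> (Y s *v x) \<le> R * (x \<bullet> (P *v x))"
    and mean: "\<And>x. \<mu> * (x \<bullet> (P *v x)) \<le> (\<Sum>s\<in>UNIV. pmf D s * (x \<bullet> (Y s *v x)))"
  shows "measure M {\<omega> \<in> space M. \<exists>x. x \<bullet> ((\<Sum>j\<in>I. Y (X j \<omega>)) *v x) < real (card I) / 2 * (x \<bullet> (P *v x))}
      \<le> real CARD('n) * exp (- (real (card I) / (2 * R) * (3/4 * \<mu> - 1/2)))"
proof -
  obtain v p where vp: "eigensystem P v p" using symmetric_matrix_eigensystem[OF psd_symmetric[OF P]] by blast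
  have Pv: "P = spectral_matrix v p" by (rule eigensystem_spectral_matrix[OF vp])
  have p: "0 \<le> p i" for i
    using psd_nonneg[OF P, of "v i"] by (simp add: eigensystem_vector[OF vp] eigensystem_norm[OF vp])
  define T where "T = spectral_matrix v (\<lambda>i. if p i = 0 then 0 else 1 / sqrt (p i))"
  define Q where "Q = spectral_matrix v (\<lambda>i. if p i = 0 then 1 else 0)"
  define W where "W s = (1 / (2 * R)) *\<^sub>R (T ** Y s ** T) + (1/2) *\<^sub>R Q" for s
  have T_sym: "transpose T = T" and Q_sym: "transpose Q = Q"
    by (simp_all add: T_def Q_def transpose_spectral_matrix)
  have W_form: "x \<bullet> (W s *v x) = 1 / (2 * R) * ((T *v x) \<bullet> (Y s *v (T *v x))) + 1/2 * (x \<bullet> (Q *v x))" for s x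
    by (simp add: W_def matrix_vector_mult_add_rdistrib inner_add_right matrix_scaleR_mult_vector
        matrix_vector_mul_assoc[symmetric] inner_symmetric_matrix[OF T_sym])
  have Q_form: "x \<bullet> (Q *v x) = (Q *v x) \<bullet> (Q *v x)" for x
    unfolding inner_symmetric_matrix[OF Q_sym, symmetric]
    by (simp add: Q_def spectral_matrix_mult_vector[OF vp] if_distrib cong: if_cong)
  have TPT: "(T *v x) \<bullet> (P *v (T *v x)) + x \<bullet> (Q *v x) = x \<bullet> x" for x
  proof -
    have "(T *v x) \<bullet> (P *v (T *v x)) = x \<bullet> (T *v (P *v (T *v x)))"
      by (simp add: inner_symmetric_matrix[OF T_sym])
    then have "(T *v x) \<bullet> (P *v (T *v x)) + x \<bullet> (Q *v x) = x \<bullet> ((T *v (P *v (T *v x))) + Q *v x)"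
      by (simp add: inner_add_right)
    also have "T *v (P *v (T *v x)) + Q *v x = (\<Sum>i\<in>UNIV. (x \<bullet> v i) *\<^sub>R v i)"
      unfolding T_def Q_def Pv spectral_matrix_mult_vector[OF vp]
      unfolding spectral_matrix_vector sum.distrib[symmetric] scaleR_add_left[symmetric]
      by (intro sum.cong refl arg_cong2[where f="(*\<^sub>R)"]) (use p in \<open>auto simp: field_simps\<close>)
    finally show ?thesis using eigensystem_expand[OF vp, of x] by simp
  qed
  have W_psd: "psd (W s)" for s
  proof -
    have "transpose (T ** Y s ** T) = T ** Y s ** T"
      by (simp only: matrix_transpose_mul T_sym psd_symmetric[OF Y] matrix_mul_assoc)
    then have "transpose (W s) = W s"
      by (simp add: W_def transpose_add transpose_scaleR Q_sym)
    moreover have "0 \<le> x \<bullet> (W s *v x)" for x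
      unfolding W_form Q_form using R(1) psd_nonneg[OF Y[of s], of "T *v x"]
      by (intro add_nonneg_nonneg mult_nonneg_nonneg) auto
    ultimately show ?thesis by (simp add: psd_def)
  qed
  have W_le: "x \<bullet> (W s *v x) \<le> 1/2 * (x \<bullet> x)" for s x
  proof -
    have "1 / (2 * R) * ((T *v x) \<bullet> (Y s *v (T *v x))) \<le> 1 / (2 * R) * (R * ((T *v x) \<bullet> (P *v (T *v x))))"
      using R(1) by (intro mult_left_mono le) simp
    then show ?thesis unfolding W_form TPT[of x, symmetric] using R(1) by simp
  qed
  have W_mean: "\<mu> / (2 * R) * (x \<bullet> x) \<le> (\<Sum>s\<in>UNIV. pmf D s * (x \<bullet> (W s *v x)))" for x
  proof -
    have "\<mu> / (2 * R) * (x \<bullet> x)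
        = 1 / (2 * R) * (\<mu> * ((T *v x) \<bullet> (P *v (T *v x)))) + \<mu> / (2 * R) * (x \<bullet> (Q *v x))"
      by (simp add: TPT[of x, symmetric] algebra_simps)
    also have "\<dots> \<le> 1 / (2 * R) * (\<Sum>s\<in>UNIV. pmf D s * ((T *v x) \<bullet> (Y s *v (T *v x)))) + 1/2 * (x \<bullet> (Q *v x))"
    proof (intro add_mono mult_left_mono mult_right_mono mean)
      show "\<mu> / (2 * R) \<le> 1/2" using R by (simp add: field_simps)
      show "0 \<le> x \<bullet> (Q *v x)" by (simp add: Q_form)
    qed (use R(1) in simp)
    also have "\<dots> = (\<Sum>s\<in>UNIV. pmf D s * (x \<bullet> (W s *v x)))"
    proof -
      have "(\<Sum>s\<in>UNIV. pmf D s * (x \<bullet> (W s *v x)))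
         = (\<Sum>s\<in>UNIV. 1 / (2 * R) * (pmf D s * ((T *v x) \<bullet> (Y s *v (T *v x)))) + pmf D s * (1/2 * (x \<bullet> (Q *v x))))"
        by (simp add: W_form algebra_simps)
      also have "\<dots> = 1 / (2 * R) * (\<Sum>s\<in>UNIV. pmf D s * ((T *v x) \<bullet> (Y s *v (T *v x))))
          + (\<Sum>s\<in>UNIV. pmf D s) * (1/2 * (x \<bullet> (Q *v x)))"
        by (simp only: sum.distrib sum_distrib_left[symmetric] sum_distrib_right[symmetric])
      finally show ?thesis by (simp add: sum_pmf_eq_1)
    qed
    finally show ?thesis .
  qed
  (* half of the number of summands, scaled by the factor 1/(2R) in the definition of W *)
  define \<tau> where "\<tau> = real (card I) / (4 * R)"
  have bad: "\<exists>z. z \<bullet> ((\<Sum>j\<in>I. W (f j)) *v z) < \<tau> * (z \<bullet> z)"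
    if "x \<bullet> ((\<Sum>j\<in>I. Y (f j)) *v x) < real (card I) / 2 * (x \<bullet> (P *v x))" for x f
  proof
    define z where "z = spectral_matrix v (\<lambda>i. sqrt (p i)) *v x"
    have zz: "z \<bullet> z = x \<bullet> (P *v x)"
      unfolding z_def inner_symmetric_matrix[OF transpose_spectral_matrix, symmetric]
      by (simp add: spectral_matrix_mult_vector[OF vp] Pv p)
    have "Q *v z = spectral_matrix v (\<lambda>_. 0) *v x"
      unfolding z_def Q_def spectral_matrix_mult_vector[OF vp]
      by (intro arg_cong2[where f="(*v)"] arg_cong2[where f=spectral_matrix] refl ext) auto
    then have Qz: "Q *v z = 0" by (simp add: spectral_matrix_vector)
    have "P *v (T *v z) = P *v x"
      unfolding z_def T_def Pv spectral_matrix_mult_vector[OF vp]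
      by (intro arg_cong2[where f="(*v)"] arg_cong2[where f=spectral_matrix] refl ext) auto
    then have "P *v (x - T *v z) = 0" by (simp add: matrix_vector_mult_diff_distrib)
    then have "Y s *v (x - T *v z) = 0" for s
      using le[of "x - T *v z" s] by (intro psd_null_vector Y) simp
    then have Yz: "(T *v z) \<bullet> (Y s *v (T *v z)) = x \<bullet> (Y s *v x)" for s
      using psd_quadratic_form_mod_kernel[OF Y] by metis
    have "z \<bullet> ((\<Sum>j\<in>I. W (f j)) *v z) = 1 / (2 * R) * (x \<bullet> ((\<Sum>j\<in>I. Y (f j)) *v x))"
      by (simp add: matrix_vector_mult_sum inner_sum_right W_form Qz Yz sum_divide_distrib)
    also have "\<dots> < 1 / (2 * R) * (real (card I) / 2 * (x \<bullet> (P *v x)))"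
      using that R(1) by (intro mult_strict_left_mono) auto
    finally show "z \<bullet> ((\<Sum>j\<in>I. W (f j)) *v z) < \<tau> * (z \<bullet> z)"
      by (simp add: zz \<tau>_def)
  qed
  interpret prob_space M by fact
  have "prob {\<omega> \<in> space M. \<exists>x. x \<bullet> ((\<Sum>j\<in>I. Y (X j \<omega>)) *v x) < real (card I) / 2 * (x \<bullet> (P *v x))}
      \<le> prob {\<omega> \<in> space M. \<exists>z. z \<bullet> ((\<Sum>j\<in>I. W (X j \<omega>)) *v z) < \<tau> * (z \<bullet> z)}"
  proof (rule finite_measure_mono)
    show "{\<omega> \<in> space M. \<exists>x. x \<bullet> ((\<Sum>j\<in>I. Y (X j \<omega>)) *v x) < real (card I) / 2 * (x \<bullet> (P *v x))}
      \<subseteq> {\<omega> \<in> space M. \<exists>z. z \<bullet> ((\<Sum>j\<in>I. W (X j \<omega>)) *v z) < \<tau> * (z \<bullet> z)}"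
      by (intro Collect_mono impI conjI) (auto intro: bad)
    show "{\<omega> \<in> space M. \<exists>z. z \<bullet> ((\<Sum>j\<in>I. W (X j \<omega>)) *v z) < \<tau> * (z \<bullet> z)} \<in> events"
      using prob_indep_finite(1)[OF M I indep sample, of "\<lambda>f. \<exists>z. z \<bullet> ((\<Sum>j\<in>I. W (f j)) *v z) < \<tau> * (z \<bullet> z)"]
      by simp
  qed
  also have "\<dots> \<le> real CARD('n) * exp (\<tau> - 3/4 * (\<mu> / (2 * R)) * real (card I))"
    by (rule matrix_Chernoff_lower[OF M I indep sample W_psd W_le W_mean])
  also have "\<tau> - 3/4 * (\<mu> / (2 * R)) * real (card I) = - (real (card I) / (2 * R) * (3/4 * \<mu> - 1/2))"
    using R(1) by (simp add: \<tau>_def field_simps)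
  finally show ?thesis .
qed

section \<open>Regularized projections\<close>

text \<open>
  The equation \<open>G (x - P x) = l P x\<close> for all \<open>x\<close> characterises \<open>P = G (G + l I)\<^sup>-\<^sup>1\<close>. It avoids
  inverses and holds both for the matrices \<^const>\<open>reg_proj\<close> and for the matrix in the lower
  bound on their expectation.
\<close>

definition regularized :: "real^'n^'n \<Rightarrow> real \<Rightarrow> real^'n^'n \<Rightarrow> bool" where
  "regularized G l P \<longleftrightarrow> (\<forall>x. G *v (x - P *v x) = l *\<^sub>R (P *v x))"

lemma regularized_form:
  assumes "regularized G l P" "0 < l"
  shows "x \<bullet> (P *v x) = (P *v x) \<bullet> (P *v x) + 1 / l * ((x - P *v x) \<bullet> (G *v (x - P *v x)))"
  using assms by (simp add: regularized_def inner_diff_left)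

text \<open>
  The quadratic form of \<open>P\<close> is the minimum of the Tikhonov functional, attained at
  \<open>y = x - P x\<close>. This makes it monotone in \<open>G\<close>.
\<close>

lemma regularized_le_Tikhonov:
  assumes P: "regularized G l P" "0 < l" and G: "psd G"
  shows "x \<bullet> (P *v x) \<le> (x - y) \<bullet> (x - y) + 1 / l * (y \<bullet> (G *v y))"
proof -
  define w where "w = x - P *v x"
  define d where "d = y - w"
  have y: "y = w + d" and xy: "x - y = P *v x - d" by (simp_all add: d_def w_def)
  have Gw: "G *v w = l *\<^sub>R (P *v x)" using P by (simp add: regularized_def w_def)
  have "w \<bullet> (G *v d) = d \<bullet> (G *v w)"
    using inner_symmetric_matrix[OF psd_symmetric[OF G]] by (metis inner_commute)
  then have "(x - y) \<bullet> (x - y) + 1 / l * (y \<bullet> (G *v y))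
      = (P *v x) \<bullet> (P *v x) + 1 / l * (w \<bullet> (G *v w)) + d \<bullet> d + 1 / l * (d \<bullet> (G *v d))"
    using \<open>0 < l\<close> unfolding xy unfolding y
    by (simp add: matrix_vector_right_distrib inner_add_left inner_add_right inner_diff_left
        inner_diff_right Gw inner_commute[of d "P *v x"] field_simps)
  moreover have "0 \<le> 1 / l * (d \<bullet> (G *v d))" using \<open>0 < l\<close> psd_nonneg[OF G] by simp
  ultimately show ?thesis
    using regularized_form[OF P, of x] by (simp add: w_def)
qed

lemma psd_regularized:
  assumes P: "regularized G l P" "0 < l" and G: "psd G"
  shows "psd P"
proof -
  have sG: "\<And>x y. x \<bullet> (G *v y) = (G *v x) \<bullet> y"
    by (rule inner_symmetric_matrix[OF psd_symmetric[OF G]])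
  have e: "G *v x = G *v (P *v x) + l *\<^sub>R (P *v x)" for x
    using P(1)[unfolded regularized_def, rule_format, of x]
    by (simp add: matrix_vector_mult_diff_distrib algebra_simps)
  have lP: "l * (x \<bullet> (P *v y)) = x \<bullet> (G *v y) - (P *v x) \<bullet> (G *v (P *v y)) - l * ((P *v x) \<bullet> (P *v y))" for x y
  proof -
    have "l * (x \<bullet> (P *v y)) = x \<bullet> (G *v y) - x \<bullet> (G *v (P *v y))"
      using arg_cong[OF e[of y], of "\<lambda>z. x \<bullet> z"] by (simp add: inner_add_right)
    also have "x \<bullet> (G *v (P *v y)) = (P *v x) \<bullet> (G *v (P *v y)) + l * ((P *v x) \<bullet> (P *v y))"
      using arg_cong[OF e[of x], of "\<lambda>z. z \<bullet> (P *v y)"] by (simp add: inner_add_left sG)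
    finally show ?thesis by simp
  qed
  have "l * (x \<bullet> (P *v y)) = l * (y \<bullet> (P *v x))" for x y
  proof -
    have "x \<bullet> (G *v y) = y \<bullet> (G *v x)" "(P *v x) \<bullet> (G *v (P *v y)) = (P *v y) \<bullet> (G *v (P *v x))"
      using sG[of x y] sG[of "P *v x" "P *v y"] by (simp_all add: inner_commute)
    then show ?thesis unfolding lP[of x y] lP[of y x] by (simp add: inner_commute)
  qed
  then have s: "x \<bullet> (P *v y) = y \<bullet> (P *v x)" for x y using \<open>0 < l\<close> by simp
  have "(transpose P) *v y = P *v y" for y
  proof (rule vector_eq_ldot[THEN iffD1], rule allI)
    fix x
    show "x \<bullet> (transpose P *v y) = x \<bullet> (P *v y)"
      using s[of x y] dot_lmul_matrix[of y P x] by (simp add: inner_commute)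
  qed
  then have "transpose P = P" by (simp add: matrix_eq)
  moreover have "0 \<le> x \<bullet> (P *v x)" for x
    unfolding regularized_form[OF P] using \<open>0 < l\<close> psd_nonneg[OF G] by simp
  ultimately show ?thesis by (simp add: psd_def)
qed

lemma regularized_le_identity:
  assumes "regularized G l P" "0 < l" "psd G"
  shows "x \<bullet> (P *v x) \<le> x \<bullet> x"
  using regularized_le_Tikhonov[OF assms, of x 0] by simp

lemma regularized_mono:
  assumes P: "regularized G l P" "0 < l" "psd G" and Q: "regularized H k Q" "0 < k"
    and le: "\<And>x. x \<bullet> (G *v x) \<le> \<alpha> * (x \<bullet> (H *v x))" and H: "psd H"
    and \<kappa>: "1 \<le> \<kappa>" "\<alpha> * (k / l) \<le> \<kappa>"
  shows "x \<bullet> (P *v x) \<le> \<kappa> * (x \<bullet> (Q *v x))"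
proof -
  let ?w = "x - Q *v x"
  have "x \<bullet> (P *v x) \<le> (Q *v x) \<bullet> (Q *v x) + 1 / l * (?w \<bullet> (G *v ?w))"
    using regularized_le_Tikhonov[OF P, of x ?w] by simp
  also have "1 / l * (?w \<bullet> (G *v ?w)) \<le> 1 / l * (\<alpha> * (?w \<bullet> (H *v ?w)))"
    using \<open>0 < l\<close> by (intro mult_left_mono le) simp
  also have "\<dots> = \<alpha> * (k / l) * (1 / k * (?w \<bullet> (H *v ?w)))"
    using \<open>0 < k\<close> by simp
  also have "\<dots> \<le> \<kappa> * (1 / k * (?w \<bullet> (H *v ?w)))"
    using \<open>0 < k\<close> psd_nonneg[OF H] by (intro mult_right_mono \<kappa>) simp
  also have "(Q *v x) \<bullet> (Q *v x) \<le> \<kappa> * ((Q *v x) \<bullet> (Q *v x))"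
    using \<kappa>(1) mult_right_mono[of 1 \<kappa> "(Q *v x) \<bullet> (Q *v x)"] by simp
  finally show ?thesis
    unfolding regularized_form[OF Q] by (simp add: distrib_left)
qed

lemma psd_transpose_mult: "psd (transpose A ** (A :: real^'n^'m))"
proof -
  have "x \<bullet> (transpose A ** A *v x) = (A *v x) \<bullet> (A *v x)" for x
    using dot_lmul_matrix[of "A *v x" A x]
    by (simp add: matrix_vector_mul_assoc[symmetric] inner_commute)
  then show ?thesis by (simp add: psd_def matrix_transpose_mul)
qed

lemma matrix_scalar_vector: "mat l *v x = l *\<^sub>R (x :: real^'n)"
  by (simp add: vec_eq_iff mat_def matrix_vector_mult_def if_distrib if_distribR cong: if_cong)

lemma regularized_matrix_inv:
  assumes H: "psd H" and l: "0 < l"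
  shows "regularized H l (H ** matrix_inv (H + mat l))"
proof -
  have "x = 0" if "(H + mat l) *v x = 0" for x
  proof -
    have "x \<bullet> (H *v x) + l * (x \<bullet> x) = 0"
      using arg_cong[OF that, of "\<lambda>z. x \<bullet> z"]
      by (simp add: matrix_vector_mult_add_rdistrib inner_add_right matrix_scalar_vector)
    then have "l * (x \<bullet> x) \<le> 0" using psd_nonneg[OF H, of x] by linarith
    then show ?thesis using l by (metis inner_gt_zero_iff mult_pos_pos not_less)
  qed
  then have "invertible (H + mat l)"
    using matrix_left_invertible_ker[of "H + mat l"] invertible_left_inverse by blast
  then have inv: "(H + mat l) ** matrix_inv (H + mat l) = mat 1"
    unfolding invertible_def matrix_inv_def by (rule someI2_ex) blast
  show ?thesis
    unfolding regularized_def
  proof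
    fix x
    define u where "u = matrix_inv (H + mat l) *v x"
    have "(H + mat l) *v u = x" by (simp add: u_def matrix_vector_mul_assoc inv)
    then have "x - H *v u = l *\<^sub>R u"
      by (simp add: matrix_vector_mult_add_rdistrib matrix_scalar_vector algebra_simps)
    then show "H *v (x - (H ** matrix_inv (H + mat l)) *v x) = l *\<^sub>R ((H ** matrix_inv (H + mat l)) *v x)"
      by (simp add: matrix_vector_mul_assoc[symmetric] u_def[symmetric] matrix_vector_mult_scaleR)
  qed
qed

section \<open>Row submatrices\<close>

text \<open>
  Replacing the rows outside \<open>S\<close> by zero rows leaves the Gram matrix of the columns unchanged
  and makes the calculus of matrices over fixed index types available.
\<close>

definition zero_rows_outside :: "real^'n^'m \<Rightarrow> 'm set \<Rightarrow> real^'n^'m" where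
  "zero_rows_outside A S = (\<chi> i a. if i \<in> S then A $ i $ a else 0)"

lemma sub_gram_zero_rows:
  "sub_gram A S = transpose (zero_rows_outside A S) ** zero_rows_outside A S"
proof -
  have "(\<Sum>k\<in>S. A $ k $ a * A $ k $ b)
      = (\<Sum>k\<in>UNIV. (if k \<in> S then A $ k $ a else 0) * (if k \<in> S then A $ k $ b else 0))" for a b
    by (rule sum.mono_neutral_cong_left) auto
  then show ?thesis
    by (simp add: vec_eq_iff sub_gram_def idx_mult_def idx_transpose_def row_submatrix_def
        matrix_matrix_mult_def transpose_def zero_rows_outside_def)
qed

lemma psd_sub_gram: "psd (sub_gram A S)"
  by (simp add: sub_gram_zero_rows psd_transpose_mult)

lemma sub_gram_le_gram:
  fixes A :: "real^'n^'m"
  shows "x \<bullet> (sub_gram A S *v x) \<le> x \<bullet> ((transpose A ** A) *v x)"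
proof -
  have gram: "x \<bullet> (transpose N ** N *v x) = (\<Sum>i\<in>UNIV. ((N *v x) $ i)\<^sup>2)" for N :: "real^'n^'m"
    using dot_lmul_matrix[of "N *v x" N x]
    by (simp add: matrix_vector_mul_assoc[symmetric] inner_commute)
       (simp add: inner_vec_def power2_eq_square)
  show ?thesis
    unfolding sub_gram_zero_rows gram
  proof (rule sum_mono)
    fix i
    show "((zero_rows_outside A S *v x) $ i)\<^sup>2 \<le> ((A *v x) $ i)\<^sup>2"
      by (cases "i \<in> S") (simp_all add: zero_rows_outside_def matrix_vector_mult_def)
  qed
qed

text \<open>
  With \<open>N\<close> for \<open>A\<close> with zero rows outside \<open>S\<close> and \<open>L\<close> for the inverse of the \<open>S \<times> S\<close>
  block, extended by zeros, \<open>(N N\<^sup>T + l I) L N = N\<close>, because the left factor is block diagonal.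
  Multiplying \<open>N (x - N\<^sup>T L N x) = l L N x\<close> by \<open>N\<^sup>T\<close> gives the claim.
\<close>

lemma regularized_reg_proj:
  fixes A :: "real^'n^'m"
  assumes l: "0 < l"
  shows "regularized (sub_gram A S) l (reg_proj A l S)"
proof -
  define N where "N = zero_rows_outside A S"
  define G where "G = (\<lambda>i j. idx_mult UNIV (row_submatrix A S) (idx_transpose (row_submatrix A S)) i j
    + idx_mat l i j)"
  define L :: "real^'m^'m" where "L = (\<chi> i j. if i \<in> S \<and> j \<in> S then idx_inv S G i j else 0)"
  have GL: "idx_mult S G (idx_inv S G) i j = idx_mat 1 i j" if "i \<in> S" "j \<in> S" for i j
    unfolding G_def by (rule ex_idx_inv(1)[OF l that])
  have proj: "reg_proj A l S = transpose N ** L ** N"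
  proof -
    have "(\<Sum>k\<in>S. (\<Sum>i\<in>S. A $ i $ a * idx_inv S G i k) * A $ k $ b)
      = (\<Sum>k\<in>UNIV. (\<Sum>i\<in>UNIV. transpose N $ a $ i * L $ i $ k) * N $ k $ b)" for a b
    proof (rule sum.mono_neutral_cong_left)
      fix k assume "k \<in> S"
      have "(\<Sum>i\<in>S. A $ i $ a * idx_inv S G i k) = (\<Sum>i\<in>UNIV. transpose N $ a $ i * L $ i $ k)"
        by (rule sum.mono_neutral_cong_left)
           (use \<open>k \<in> S\<close> in \<open>auto simp: N_def L_def zero_rows_outside_def transpose_def\<close>)
      then show "(\<Sum>i\<in>S. A $ i $ a * idx_inv S G i k) * A $ k $ b
          = (\<Sum>i\<in>UNIV. transpose N $ a $ i * L $ i $ k) * N $ k $ b"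
        using \<open>k \<in> S\<close> by (simp add: N_def zero_rows_outside_def)
    qed (auto simp: N_def zero_rows_outside_def)
    then show ?thesis
      unfolding reg_proj_def Let_def G_def[symmetric]
      by (simp add: vec_eq_iff idx_mult_def idx_transpose_def row_submatrix_def matrix_matrix_mult_def)
  qed
  have KL: "((N ** transpose N + mat l) ** L) $ i $ j = (if i \<in> S \<and> i = j then 1 else 0)" for i j
  proof -
    have K: "(N ** transpose N + mat l) $ i $ k = (if i \<in> S \<and> k \<in> S then G i k else if i = k then l else 0)" for k
      by (auto simp: matrix_matrix_mult_def transpose_def mat_def N_def zero_rows_outside_def
          G_def idx_mult_def idx_transpose_def idx_mat_def row_submatrix_def)
    have "((N ** transpose N + mat l) ** L) $ i $ j
       = (\<Sum>k\<in>UNIV. (N ** transpose N + mat l) $ i $ k * L $ k $ j)"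
      by (simp add: matrix_matrix_mult_def)
    also have "\<dots> = (if i \<in> S \<and> i = j then 1 else 0)"
    proof (cases "i \<in> S \<and> j \<in> S")
      case True
      have "(\<Sum>k\<in>UNIV. (N ** transpose N + mat l) $ i $ k * L $ k $ j) = (\<Sum>k\<in>S. G i k * idx_inv S G k j)"
        unfolding K by (rule sum.mono_neutral_cong_right) (use True in \<open>auto simp: L_def\<close>)
      also have "\<dots> = (if i = j then 1 else 0)"
        using GL[of i j] True by (simp add: idx_mult_def idx_mat_def)
      finally show ?thesis using True by simp
    next
      case False
      have "(N ** transpose N + mat l) $ i $ k * L $ k $ j = 0" for k
        unfolding K using False by (auto simp: L_def)
      then have "(\<Sum>k\<in>UNIV. (N ** transpose N + mat l) $ i $ k * L $ k $ j) = 0"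
        by (intro sum.neutral) blast
      then show ?thesis using False by auto
    qed
    finally show ?thesis .
  qed
  have KLN: "(N ** transpose N + mat l) ** L ** N = N"
  proof -
    have "((N ** transpose N + mat l) ** L ** N) $ i $ a = N $ i $ a" for i a
    proof -
      have "((N ** transpose N + mat l) ** L ** N) $ i $ a
          = (\<Sum>k\<in>UNIV. ((N ** transpose N + mat l) ** L) $ i $ k * N $ k $ a)"
        by (simp add: matrix_matrix_mult_def[of _ N])
      also have "\<dots> = (\<Sum>k\<in>UNIV. if k = i then N $ i $ a else 0)"
        unfolding KL by (rule sum.cong) (auto simp: N_def zero_rows_outside_def)
      finally show ?thesis by simp
    qed
    then show ?thesis by (simp add: vec_eq_iff)
  qed
  show ?thesis
    unfolding regularized_def
  proof
    fix x
    define u where "u = L *v (N *v x)"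
    have Px: "reg_proj A l S *v x = transpose N *v u"
      unfolding proj u_def by (simp only: matrix_vector_mul_assoc matrix_mul_assoc)
    have "N *v x = ((N ** transpose N + mat l) ** L ** N) *v x" by (simp add: KLN)
    also have "\<dots> = N *v (transpose N *v u) + l *\<^sub>R u"
      unfolding u_def
      by (simp only: matrix_vector_mul_assoc[symmetric] matrix_vector_mult_add_rdistrib
          matrix_scalar_vector)
    finally have "N *v (x - transpose N *v u) = l *\<^sub>R u"
      by (simp add: matrix_vector_mult_diff_distrib del: transpose_matrix_vector)
    then show "sub_gram A S *v (x - reg_proj A l S *v x) = l *\<^sub>R (reg_proj A l S *v x)"
      unfolding Px sub_gram_zero_rows N_def[symmetric] matrix_vector_mul_assoc[symmetric]
      by (simp add: matrix_vector_mult_scaleR del: transpose_matrix_vector)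
  qed
qed

lemma psd_reg_proj: "0 < l \<Longrightarrow> psd (reg_proj A l S)"
  using psd_regularized[OF regularized_reg_proj _ psd_sub_gram] by blast

section \<open>Sampling regularized projections\<close>

text \<open>
  If a sampled matrix is dropped with probability at most \<open>\<alpha> / norm (pinv P)\<close>, then at most
  the fraction \<open>\<alpha>\<close> of the expectation \<open>P\<close> is lost: the dropped part is at most the identity, and
  on the range of \<open>P\<close> the identity is at most \<open>norm (pinv P) P\<close>.
\<close>

lemma truncated_expectation_lower_bound:
  fixes D :: "'s::finite pmf" and Y :: "'s \<Rightarrow> real^'n^'n"
  assumes P: "psd P" and Y: "\<And>s. psd (Y s)" "\<And>s x. x \<bullet> (Y s *v x) \<le> x \<bullet> x"
    and mean: "\<And>x. x \<bullet> (P *v x) = (\<Sum>s\<in>UNIV. pmf D s * (x \<bullet> (Y s *v x)))"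
    and \<alpha>: "0 \<le> \<alpha>" and \<delta>: "\<delta> \<le> \<alpha> / spectral_norm (pinv P)"
    and good: "1 - \<delta> \<le> measure_pmf.prob D G"
  shows "(1 - \<alpha>) * (x \<bullet> (P *v x)) \<le> (\<Sum>s\<in>G. pmf D s * (x \<bullet> (Y s *v x)))"
proof -
  obtain y where y: "P *v (x - y) = 0" "y \<bullet> y \<le> spectral_norm (pinv P) * (y \<bullet> (P *v y))"
    using psd_range_lower_bound[OF P] by blast
  have "pmf D s * ((x - y) \<bullet> (Y s *v (x - y))) = 0" for s
  proof -
    have "(\<Sum>s\<in>UNIV. pmf D s * ((x - y) \<bullet> (Y s *v (x - y)))) = 0"
      using mean[of "x - y"] y(1) by simp
    then show ?thesis
      using psd_nonneg[OF Y(1)] by (simp add: sum_nonneg_eq_0_iff)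
  qed
  then have same: "pmf D s * (x \<bullet> (Y s *v x)) = pmf D s * (y \<bullet> (Y s *v y))" for s
  proof (cases "pmf D s = 0")
    case False
    then have "(x - y) \<bullet> (Y s *v (x - y)) = 0"
      using \<open>pmf D s * ((x - y) \<bullet> (Y s *v (x - y))) = 0\<close> by simp
    then have "Y s *v (x - y) = 0" by (intro psd_null_vector Y) simp
    then show ?thesis using psd_quadratic_form_mod_kernel[OF Y(1)] by metis
  qed simp
  have "(\<Sum>s\<in>UNIV - G. pmf D s) = 1 - measure_pmf.prob D G"
    using sum_pmf_eq_1[of UNIV D] sum.subset_diff[of G UNIV "pmf D"]
    by (simp add: measure_measure_pmf_finite)
  then have bad: "(\<Sum>s\<in>UNIV - G. pmf D s) \<le> \<delta>" using good by simp
  have "(\<Sum>s\<in>UNIV - G. pmf D s * (y \<bullet> (Y s *v y))) \<le> (\<Sum>s\<in>UNIV - G. pmf D s * (y \<bullet> y))"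
    by (intro sum_mono mult_left_mono Y) simp
  also have "\<dots> \<le> \<delta> * (y \<bullet> y)"
    unfolding sum_distrib_right[symmetric] by (intro mult_right_mono bad) simp
  also have "\<dots> \<le> \<alpha> * (y \<bullet> (P *v y))"
  proof (cases "spectral_norm (pinv P) > 0")
    case True
    have "\<delta> * (y \<bullet> y) \<le> \<alpha> / spectral_norm (pinv P) * (y \<bullet> y)"
      by (intro mult_right_mono \<delta>) simp
    also have "\<dots> \<le> \<alpha> / spectral_norm (pinv P) * (spectral_norm (pinv P) * (y \<bullet> (P *v y)))"
      using True \<alpha> by (intro mult_left_mono y) simp
    finally show ?thesis using True by simp
  next
    case False
    then have "spectral_norm (pinv P) * (y \<bullet> (P *v y)) \<le> 0"
      using psd_nonneg[OF P, of y] by (simp add: mult_nonpos_nonneg)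
    with y(2) have "y \<bullet> y \<le> 0" by linarith
    then have "y = 0" by (metis inner_gt_zero_iff not_less)
    then show ?thesis by simp
  qed
  finally have "(\<Sum>s\<in>UNIV - G. pmf D s * (x \<bullet> (Y s *v x))) \<le> \<alpha> * (y \<bullet> (P *v y))"
    by (simp add: same)
  moreover have "y \<bullet> (P *v y) = x \<bullet> (P *v x)"
    using psd_quadratic_form_mod_kernel[OF P y(1)] by simp
  moreover have "x \<bullet> (P *v x) = (\<Sum>s\<in>UNIV - G. pmf D s * (x \<bullet> (Y s *v x))) + (\<Sum>s\<in>G. pmf D s * (x \<bullet> (Y s *v x)))"
    unfolding mean by (rule sum.subset_diff) auto
  ultimately show ?thesis by (simp add: left_diff_distrib)
qed

text \<open>
  Dropping the samples outside \<open>G\<close> can only decrease the sum, so that the assertion for the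
  full sum follows from the one for the truncated sum.
\<close>

lemma sampling_bound:
  fixes D :: "'s::finite pmf" and Y :: "'s \<Rightarrow> real^'n^'n" and X :: "nat \<Rightarrow> 'w \<Rightarrow> 's"
  assumes M: "prob_space M" and B: "0 < B"
    and indep: "prob_space.indep_vars M (\<lambda>_. count_space UNIV) X {1..B}"
    and sample: "\<And>j. j \<in> {1..B} \<Longrightarrow> distr M (count_space UNIV) (X j) = measure_pmf D"
    and P: "psd P" and Y: "\<And>s. psd (Y s)"
    and R: "0 < R" "\<mu> \<le> R"
    and le: "\<And>s x. s \<in> G \<Longrightarrow> x \<bullet> (Y s *v x) \<le> R * (x \<bullet> (P *v x))"
    and mean: "\<And>x. \<mu> * (x \<bullet> (P *v x)) \<le> (\<Sum>s\<in>G. pmf D s * (x \<bullet> (Y s *v x)))"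
    and \<delta>: "0 < \<delta>" "\<delta> < 1"
    and exponent: "ln (2 * real CARD('n) / \<delta>) \<le> real B / (2 * R) * (3/4 * \<mu> - 1/2)"
  shows "1 - \<delta> \<le> measure M {\<omega> \<in> space M. (1/2) *\<^sub>R P \<preceq>\<^sub>L (1 / real B) *\<^sub>R (\<Sum>j=1..B. Y (X j \<omega>))}"
proof -
  interpret prob_space M by fact
  define Z where "Z s = (if s \<in> G then Y s else 0)" for s
  have Z_psd: "psd (Z s)" for s
    using Y[of s] by (simp add: Z_def psd_def transpose_def vec_eq_iff)
  have Z_le: "x \<bullet> (Z s *v x) \<le> R * (x \<bullet> (P *v x))" for s x
    using le psd_nonneg[OF P, of x] R(1) by (simp add: Z_def)
  have "(\<Sum>s\<in>G. pmf D s * (x \<bullet> (Y s *v x))) = (\<Sum>s\<in>UNIV. pmf D s * (x \<bullet> (Z s *v x)))" for x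
    by (rule sum.mono_neutral_cong_left) (auto simp: Z_def)
  with mean have Z_mean: "\<mu> * (x \<bullet> (P *v x)) \<le> (\<Sum>s\<in>UNIV. pmf D s * (x \<bullet> (Z s *v x)))" for x
    by simp
  define bad where "bad = {\<omega> \<in> space M. \<exists>x. x \<bullet> ((\<Sum>j\<in>{1..B}. Z (X j \<omega>)) *v x) < real (card {1..B}) / 2 * (x \<bullet> (P *v x))}"
  define goal where "goal = {\<omega> \<in> space M. (1/2) *\<^sub>R P \<preceq>\<^sub>L (1 / real B) *\<^sub>R (\<Sum>j=1..B. Y (X j \<omega>))}"
  have I: "finite {1..B}" "{1..B} \<noteq> {}" using B by auto
  have "prob bad \<le> real CARD('n) * exp (- (real (card {1..B}) / (2 * R) * (3/4 * \<mu> - 1/2)))"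
    unfolding bad_def
    by (rule matrix_Chernoff_lower_relative[OF M I indep sample P Z_psd R Z_le Z_mean])
  also have "\<dots> \<le> real CARD('n) * exp (- ln (2 * real CARD('n) / \<delta>))"
    using exponent by simp
  also have "\<dots> = \<delta> / 2"
    using \<delta> by (simp add: exp_minus)
  finally have "prob bad \<le> \<delta>" using \<delta> by simp
  moreover have bad_event: "bad \<in> events"
    using prob_indep_finite(1)[OF M I indep sample,
        of "\<lambda>f. \<exists>x. x \<bullet> ((\<Sum>j\<in>{1..B}. Z (f j)) *v x) < real (card {1..B}) / 2 * (x \<bullet> (P *v x))"]
    by (simp add: bad_def)
  moreover have goal_event: "goal \<in> events"
    using prob_indep_finite(1)[OF M I indep sample,
        of "\<lambda>f. (1/2) *\<^sub>R P \<preceq>\<^sub>L (1 / real B) *\<^sub>R (\<Sum>j=1..B. Y (f j))"]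
    by (simp add: goal_def)
  moreover have "space M - bad \<subseteq> goal"
  proof
    fix \<omega> assume \<omega>: "\<omega> \<in> space M - bad"
    have "(1/2) *\<^sub>R P \<preceq>\<^sub>L (1 / real B) *\<^sub>R (\<Sum>j=1..B. Y (X j \<omega>))"
    proof (rule loewner_leI)
      fix x
      have "real B / 2 * (x \<bullet> (P *v x)) \<le> x \<bullet> ((\<Sum>j\<in>{1..B}. Z (X j \<omega>)) *v x)"
        using \<omega> by (auto simp: bad_def not_less)
      also have "\<dots> \<le> x \<bullet> ((\<Sum>j\<in>{1..B}. Y (X j \<omega>)) *v x)"
        unfolding matrix_vector_mult_sum inner_sum_right
        by (rule sum_mono) (simp add: Z_def psd_nonneg[OF Y])
      finally show "x \<bullet> (((1/2) *\<^sub>R P) *v x) \<le> x \<bullet> (((1 / real B) *\<^sub>R (\<Sum>j=1..B. Y (X j \<omega>))) *v x)"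
        using B by (simp add: matrix_scaleR_mult_vector field_simps)
    qed (simp_all add: transpose_scaleR transpose_sum psd_symmetric[OF P] psd_symmetric[OF Y])
    with \<omega> show "\<omega> \<in> goal" by (simp add: goal_def)
  qed
  ultimately show ?thesis
    using finite_measure_mono[of "space M - bad" goal] prob_compl[of bad]
    unfolding goal_def[symmetric] by simp
qed

section \<open>The approximation guarantee\<close>

theorem theorem4p2:
  fixes A :: "real^'n^'m"
    and lam lam_bar c \<alpha> \<delta> \<delta>' :: real
    and D :: "'m set pmf"
    and P_bar :: "real^'n^'n"
    and M :: "'w measure"
    and X :: "nat \<Rightarrow> 'w \<Rightarrow> 'm set"
    and B :: nat
  assumes lam: "0 < lam" "lam \<le> lam_bar"
    and P_bar: "P_bar = measure_pmf.expectation D (\<lambda>S. reg_proj A lam S)"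
    and c: "0 < c" "c \<le> 1"
    and lower: "c *\<^sub>R (transpose A ** A ** matrix_inv (transpose A ** A + mat lam_bar)) \<preceq>\<^sub>L P_bar"
    and alpha: "0 \<le> \<alpha>" "\<alpha> \<le> 1"
    and delta': "0 \<le> \<delta>'" "\<delta>' \<le> \<alpha> / spectral_norm (pinv P_bar)"
    and good: "measure_pmf.prob D {S. sub_gram A S \<preceq>\<^sub>L \<alpha> *\<^sub>R (transpose A ** A)} \<ge> 1 - \<delta>'"
    and prob_M: "prob_space M"
    and indep: "prob_space.indep_vars M (\<lambda>_. count_space UNIV) X {1..B}"
    and sample: "\<And>j. j \<in> {1..B} \<Longrightarrow> distr M (count_space UNIV) (X j) = measure_pmf D"
    and delta: "0 < \<delta>" "\<delta> < 1"
    and B: "real B \<ge> 40 / c * (1 + \<alpha> * (lam_bar / lam)) * ln (2 * real CARD('n) / \<delta>)"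
  shows "measure M {\<omega> \<in> space M.
           (1 / 2) *\<^sub>R P_bar \<preceq>\<^sub>L (1 / real B) *\<^sub>R (\<Sum>j=1..B. reg_proj A lam (X j \<omega>))}
         \<ge> 1 - real B * \<delta>' - \<delta>"
proof -
  define H where "H = transpose A ** A"
  define Q where "Q = H ** matrix_inv (H + mat lam_bar)"
  define Y where "Y = reg_proj A lam"
  define r where "r = lam_bar / lam"
  define L where "L = ln (2 * real CARD('n) / \<delta>)"
  have lam_bar: "0 < lam_bar" using lam by simp
  have r: "1 \<le> r" using lam by (simp add: r_def)
  have H: "psd H" unfolding H_def by (rule psd_transpose_mult)
  have Q: "regularized H lam_bar Q" unfolding Q_def by (rule regularized_matrix_inv[OF H lam_bar])
  have Y_reg: "regularized (sub_gram A S) lam (Y S)" for S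
    unfolding Y_def by (rule regularized_reg_proj[OF lam(1)])
  have Y: "psd (Y S)" for S unfolding Y_def by (rule psd_reg_proj[OF lam(1)])
  have P_sum: "P_bar = (\<Sum>S\<in>UNIV. pmf D S *\<^sub>R Y S)"
    unfolding P_bar Y_def by (rule integral_measure_pmf[of UNIV]) auto
  have P_form: "x \<bullet> (P_bar *v x) = (\<Sum>S\<in>UNIV. pmf D S * (x \<bullet> (Y S *v x)))" for x
    by (simp add: P_sum matrix_vector_mult_sum inner_sum_right matrix_scaleR_mult_vector)
  have P: "psd P_bar"
    unfolding psd_def P_form
    by (auto simp: P_sum transpose_sum transpose_scaleR psd_symmetric[OF Y]
        intro!: sum_nonneg mult_nonneg_nonneg psd_nonneg[OF Y])
  have Q_le: "x \<bullet> (Q *v x) \<le> 1 / c * (x \<bullet> (P_bar *v x))" for x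
    using loewner_leD[OF lower, of x] c
    by (simp add: Q_def H_def matrix_scaleR_mult_vector field_simps)
  have Y_le: "x \<bullet> (Y S *v x) \<le> \<kappa> / c * (x \<bullet> (P_bar *v x))"
    if "\<And>x. x \<bullet> (sub_gram A S *v x) \<le> a * (x \<bullet> (H *v x))" "1 \<le> \<kappa>" "a * r \<le> \<kappa>" for S a \<kappa> x
  proof -
    have "x \<bullet> (Y S *v x) \<le> \<kappa> * (x \<bullet> (Q *v x))"
      by (rule regularized_mono[OF Y_reg lam(1) psd_sub_gram Q lam_bar that(1) H that(2)])
         (use that(3) in \<open>simp add: r_def\<close>)
    also have "\<dots> \<le> \<kappa> * (1 / c * (x \<bullet> (P_bar *v x)))"
      using that(2) by (intro mult_left_mono Q_le) simp
    finally show ?thesis by simp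
  qed
  have "1 \<le> real CARD('n)" by simp
  then have "\<delta> < 2 * real CARD('n)" using delta by linarith
  then have L_pos: "0 < L" using delta by (simp add: L_def)
  have B_L: "40 / c * (1 + \<alpha> * r) * L \<le> real B" using B by (simp add: r_def L_def)
  have \<alpha>r: "0 \<le> \<alpha> * r" using alpha r by simp
  have "0 < 40 / c * (1 + \<alpha> * r) * L" using c \<alpha>r L_pos by simp
  with B_L have "0 < B" by (metis less_le_trans of_nat_0_less_iff)
  note bound = sampling_bound[OF prob_M \<open>0 < B\<close> indep sample P Y _ _ _ _ delta]
  have "1 - \<delta> \<le> measure M {\<omega> \<in> space M. (1 / 2) *\<^sub>R P_bar \<preceq>\<^sub>L (1 / real B) *\<^sub>R (\<Sum>j=1..B. Y (X j \<omega>))}"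
  (* The threshold 1/4 leaves room in both cases for the factor 40: the exponent is at least
     5/4 L, from 40 L / 2 * (9/16 - 1/2) below it and from 10 L / 2 * (3/4 - 1/2) above it. *)
  proof (cases "\<alpha> < 1/4")
    case True
    define G where "G = {S. sub_gram A S \<preceq>\<^sub>L \<alpha> *\<^sub>R H}"
    define R where "R = (1 + \<alpha> * r) / c"
    have "1 * c \<le> 1 + \<alpha> * r" using c \<alpha>r by simp
    then have R: "1 \<le> R" using c by (simp add: R_def pos_le_divide_eq)
    show ?thesis
    proof (rule bound)
      show "0 < R" "3/4 \<le> R" using R by simp_all
      show "x \<bullet> (Y S *v x) \<le> R * (x \<bullet> (P_bar *v x))" if "S \<in> G" for S x
        unfolding R_def
      proof (rule Y_le)
        show "x \<bullet> (sub_gram A S *v x) \<le> \<alpha> * (x \<bullet> (H *v x))" for x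
          using loewner_leD[of "sub_gram A S" "\<alpha> *\<^sub>R H" x] that
          by (simp add: G_def matrix_scaleR_mult_vector)
      qed (use \<alpha>r in simp_all)
      show "3/4 * (x \<bullet> (P_bar *v x)) \<le> (\<Sum>S\<in>G. pmf D S * (x \<bullet> (Y S *v x)))" for x
      proof -
        have "3/4 * (x \<bullet> (P_bar *v x)) \<le> (1 - \<alpha>) * (x \<bullet> (P_bar *v x))"
          using True psd_nonneg[OF P] by (intro mult_right_mono) auto
        also have "\<dots> \<le> (\<Sum>S\<in>G. pmf D S * (x \<bullet> (Y S *v x)))"
          using good regularized_le_identity[OF Y_reg lam(1) psd_sub_gram]
          by (intro truncated_expectation_lower_bound[OF P Y _ P_form alpha(1) delta'(2)])
             (auto simp: G_def H_def)
        finally show ?thesis .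
      qed
      have "40 * R * L \<le> real B" using B_L by (simp add: R_def)
      then have "40 * L \<le> real B / R" using R by (simp add: pos_le_divide_eq mult_ac)
      then show "ln (2 * real CARD('n) / \<delta>) \<le> real B / (2 * R) * (3/4 * (3/4) - 1/2)"
        using L_pos unfolding L_def by simp
    qed
  next
    case False
    define R where "R = r / c"
    have R: "1 \<le> R" using c r by (simp add: R_def pos_le_divide_eq)
    show ?thesis
    proof (rule bound)
      show "0 < R" "1 \<le> R" using R by simp_all
      show "x \<bullet> (Y S *v x) \<le> R * (x \<bullet> (P_bar *v x))" if "S \<in> UNIV" for S x
        unfolding R_def by (rule Y_le[of S 1]) (use r sub_gram_le_gram in \<open>auto simp: H_def\<close>)
      show "1 * (x \<bullet> (P_bar *v x)) \<le> (\<Sum>S\<in>UNIV. pmf D S * (x \<bullet> (Y S *v x)))" for x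
        by (simp add: P_form)
      have "1/4 * r \<le> \<alpha> * r" using False r by (intro mult_right_mono) auto
      then have "40 / c * (1/4 * r) * L \<le> 40 / c * (1 + \<alpha> * r) * L"
        using c L_pos by (intro mult_right_mono mult_left_mono) auto
      with B_L have "10 * R * L \<le> real B" by (simp add: R_def)
      then have "10 * L \<le> real B / R" using R by (simp add: pos_le_divide_eq mult_ac)
      then show "ln (2 * real CARD('n) / \<delta>) \<le> real B / (2 * R) * (3/4 * 1 - 1/2)"
        using L_pos unfolding L_def by simp
    qed
  qed
  moreover have "0 \<le> real B * \<delta>'" using delta' by simp
  ultimately show ?thesis unfolding Y_def by linarith
qed

end
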